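(* Let $s$ be a composition, $h$ an admissible height function for the DKK triangulation of $\mathcal F_{G_s}$, $1\le a<c\le n$, and let $w=u_1B_acu_2$ and $w'=u_1cB_au_2$ be Stirling $s$-permutations, where $B_a$ is the $a$-block. Then the edge of $\mathcal P_h$ corresponding to the transposition between $w$ and $w'$ satisfies \[ v(w')-v(w)=\Big(h(\mathrm{route}(u_1c))+h(\mathrm{route}(u_1B_a))-h(\mathrm{route}(u_1))-h(\mathrm{route}(u_1B_ac))\Big)(\mathbf e_a-\mathbf e_c), \] where $(\mathbf e_i)$ is the standard basis of $\mathbb R^n$.
   Context: $s=(s_1,\dots,s_n)$ is a composition. Stirling $s$-permutation: word with each $i\in[n]$ occurring $s_i$ times, avoiding $121$; the $a$-block $B_a$ is the shortest consecutive substring containing all $a$'s; $w_{[i]}$ is the prefix of length $i$. Graph $G_s$ ($s_{n+1}:=2$): vertices $v_{-1},\dots,v_n$; source-edges $e^i_1,\dots,e^i_{s_i-1}$ from $v_{-1}$ to $v_{n+1-i}$ ($i\in[1,n+1]$); bump $e^i_0$ and dip $e^i_{s_i}$ from $v_{n-i}$ to $v_{n+1-i}$ ($i\in[1,n]$). Routes: $R(k,t,\delta)=(e^k_t,e^{k-1}_{\delta_{k-1}s_{k-1}},\dots,e^1_{\delta_1s_1})$. $\mathcal F_{G_s}$: unit flow polytope in $\mathbb R^E$ with vertices the route indicator vectors $\chi_R$. Framing: incoming edges at $v_{n+1-i}$ ordered $e^i_0\prec\dots\prec e^i_{s_i}$, outgoing ordered $e^{i-1}_0\prec e^{i-1}_{s_{i-1}}$.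 Coherence of two routes: at each maximal common subpath between inner vertices $v_i,v_j$, initial parts up to $v_i$ and final parts from $v_j$ are ordered alike (compared by framing order at the vertex of last, resp. first, divergence). Simplices spanned by pairwise coherent routes form the DKK triangulation; $h$ is admissible if the DKK triangulation is the projection of the lower faces of $\mathrm{conv}\{(\chi_R,h(R))\}$. $F^k_t(x)=\min_{\delta\in\{0,1\}^{k-1}}(h(R(k,t,\delta))+\sum_{i<k}\delta_ix_i)$ for $k\in[2,n+1]$, $t\in[1,s_k-1]$, with minimizer set $M^k_t(x)$; cells $C(x)=\{y:M^k_t(x)\subseteq M^k_t(y)\ \forall k,t\}$; $\mathcal P_h$ is the complex of bounded cells. For a prefix $u$: $t_a$ = number of $a$'s, $c$ = smallest $a$ with $0<t_a<s_a$ (else $c=n+1$, $t_{n+1}=1$), $\mathrm{route}(u)=(e^c_{t_c},\dots,e^1_{t_1})$; $\Delta_w=\{\mathrm{route}(w_{[i]})\}$. $v(w)$ is the vertex of $\mathcal P_h$ associated to $w$: the point $x$ with $\delta\in M^k_t(x)$ for every $R(k,t,\delta)\in\Delta_w$ with $k\ge2$. *)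

theory Defs
  imports "HOL-Analysis.Analysis" "HOL-Analysis.Finite_Function_Topology"
    "HOL-Library.Sublist" "Graph_Theory.Arc_Walk"
begin

text \<open>
  A composition \<open>s = (s\<^sub>1, \<dots>, s\<^sub>n)\<close> is a list of positive naturals, with \<open>n = length s\<close>.
  Letters, edge superscripts and coordinates are 1-based. Vectors are finitely supported
  functions \<open>_ \<Rightarrow>\<^sub>0 real\<close>, so that \<open>Poly_Mapping.single i 1\<close> is a standard basis vector.
\<close>

definition composition :: "nat list \<Rightarrow> bool" where
  "composition s \<longleftrightarrow> (\<forall>x\<in>set s. 0 < x)"

text \<open>\<open>part s i\<close> is \<open>s\<^sub>i\<close>, including the convention \<open>s\<^sub>n\<^sub>+\<^sub>1 = 2\<close>.\<close>

definition part :: "nat list \<Rightarrow> nat \<Rightarrow> nat" where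
  "part s i = (s @ [2]) ! (i - 1)"


subsection \<open>Stirling permutations\<close>

definition avoids_121 :: "nat list \<Rightarrow> bool" where
  "avoids_121 w \<longleftrightarrow>
     \<not> (\<exists>i j k. i < j \<and> j < k \<and> k < length w \<and> w ! i = w ! k \<and> w ! i < w ! j)"

definition stirling_perm :: "nat list \<Rightarrow> nat list \<Rightarrow> bool" where
  "stirling_perm s w \<longleftrightarrow>
     set w \<subseteq> {1..length s} \<and>
     (\<forall>i\<in>{1..length s}. count_list w i = part s i) \<and>
     avoids_121 w"

definition is_block :: "nat \<Rightarrow> nat list \<Rightarrow> nat list \<Rightarrow> bool" where
  "is_block a w B \<longleftrightarrow>
     sublist B w \<and> count_list B a = count_list w a \<and>
     (\<forall>B'. sublist B' w \<and> count_list B' a = count_list w a \<longrightarrow> length B \<le> length B')"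


subsection \<open>The framed graph and its routes\<close>

text \<open>The edge \<open>e\<^sup>i\<^sub>t\<close> is the pair \<open>(i, t)\<close>, the vertex \<open>v\<^sub>j\<close> is the integer \<open>j\<close>.\<close>

type_synonym edge = "nat \<times> nat"

definition source_edges :: "nat list \<Rightarrow> edge set" where
  "source_edges s = {(i, t). i \<in> {1..length s + 1} \<and> t \<in> {1..part s i - 1}}"

definition bumps_dips :: "nat list \<Rightarrow> edge set" where
  "bumps_dips s = {(i, t). i \<in> {1..length s} \<and> t \<in> {0, part s i}}"

definition Gs :: "nat list \<Rightarrow> (int, edge) pre_digraph" where
  "Gs s =
     \<lparr> verts = {-1..int (length s)},
       arcs = source_edges s \<union> bumps_dips s,
       tail = (\<lambda>e. if e \<in> source_edges s then -1 else int (length s) - int (fst e)),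
       head = (\<lambda>e. int (length s) + 1 - int (fst e)) \<rparr>"

text \<open>Directed walks in this acyclic graph are paths.\<close>

definition routes :: "nat list \<Rightarrow> edge list set" where
  "routes s = {p. pre_digraph.awalk (Gs s) (-1) p (int (length s))}"

text \<open>
  The edges entering a vertex share their superscript, and so do the edges leaving an inner
  vertex. In both cases the framing is the order by subscript.
\<close>

definition framing_less :: "edge \<Rightarrow> edge \<Rightarrow> bool" where
  "framing_less e f \<longleftrightarrow> snd e < snd f"

text \<open>
  Comparison of paths with the same end (resp. the same start) at the vertex of last
  (resp. first) divergence.
\<close>

definition initial_less :: "nat list \<Rightarrow> edge list \<Rightarrow> edge list \<Rightarrow> bool" where
  "initial_less s P Q \<longleftrightarrow>
     (\<exists>P' Q' e f Z. P = P' @ e # Z \<and> Q = Q' @ f # Z \<and> e \<noteq> f \<and>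
        head (Gs s) e = head (Gs s) f \<and> framing_less e f)"

definition final_less :: "nat list \<Rightarrow> edge list \<Rightarrow> edge list \<Rightarrow> bool" where
  "final_less s P Q \<longleftrightarrow>
     (\<exists>P' Q' e f Z. P = Z @ e # P' \<and> Q = Z @ f # Q' \<and> e \<noteq> f \<and>
        tail (Gs s) e = tail (Gs s) f \<and> framing_less e f)"

text \<open>
  \<open>M\<close> is a maximal common subpath from \<open>v\<^sub>i\<close> to \<open>v\<^sub>j\<close>; it may be a single vertex (\<open>M = []\<close>).
  Both endpoints are inner because all four outer parts are nonempty.
\<close>

definition coherent :: "nat list \<Rightarrow> edge list \<Rightarrow> edge list \<Rightarrow> bool" where
  "coherent s P Q \<longleftrightarrow>
     (\<forall>P1 P2 Q1 Q2 M.
        P = P1 @ M @ P2 \<and> Q = Q1 @ M @ Q2 \<and>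
        P1 \<noteq> [] \<and> P2 \<noteq> [] \<and> Q1 \<noteq> [] \<and> Q2 \<noteq> [] \<and>
        head (Gs s) (last P1) = head (Gs s) (last Q1) \<and>
        last P1 \<noteq> last Q1 \<and> hd P2 \<noteq> hd Q2 \<longrightarrow>
        (initial_less s P1 Q1 \<longleftrightarrow> final_less s P2 Q2))"


subsection \<open>The Danilov--Karzanov--Koshevoy triangulation and admissible height functions\<close>

definition indicator_vec :: "edge list \<Rightarrow> edge \<Rightarrow>\<^sub>0 real" where
  "indicator_vec R = (\<Sum>e\<in>set R. Poly_Mapping.single e 1)"

definition DKK :: "nat list \<Rightarrow> (edge \<Rightarrow>\<^sub>0 real) set set" where
  "DKK s = {convex hull (indicator_vec ` C) | C.
     C \<noteq> {} \<and> C \<subseteq> routes s \<and> (\<forall>P\<in>C. \<forall>Q\<in>C. coherent s P Q)}"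

text \<open>
  A lower face minimises a linear functional whose last coefficient is positive; that
  coefficient is normalised to 1.
\<close>

definition lower_faces :: "('v::real_vector \<times> real) set \<Rightarrow> ('v \<times> real) set set" where
  "lower_faces P = {F. \<exists>\<phi> :: 'v \<Rightarrow> real. linear \<phi> \<and>
     F = {p \<in> P. \<forall>q\<in>P. \<phi> (fst p) + snd p \<le> \<phi> (fst q) + snd q}}"

definition admissible :: "nat list \<Rightarrow> (edge list \<Rightarrow> real) \<Rightarrow> bool" where
  "admissible s h \<longleftrightarrow>
     (\<lambda>F. fst ` F) ` lower_faces (convex hull ((\<lambda>R. (indicator_vec R, h R)) ` routes s)) = DKK s"


subsection \<open>The polyhedral complex of bounded cells\<close>

definition cube :: "nat \<Rightarrow> (nat \<Rightarrow> nat) set" where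
  "cube k = {1..<k} \<rightarrow>\<^sub>E {0, 1}"

text \<open>\<open>rev [1..<k]\<close> is the list \<open>k - 1, \<dots>, 1\<close>.\<close>

definition route_R :: "nat list \<Rightarrow> nat \<Rightarrow> nat \<Rightarrow> (nat \<Rightarrow> nat) \<Rightarrow> edge list" where
  "route_R s k t \<delta> = (k, t) # map (\<lambda>i. (i, \<delta> i * part s i)) (rev [1..<k])"

definition trop_term ::
  "nat list \<Rightarrow> (edge list \<Rightarrow> real) \<Rightarrow> nat \<Rightarrow> nat \<Rightarrow> (nat \<Rightarrow> nat) \<Rightarrow> (nat \<Rightarrow>\<^sub>0 real) \<Rightarrow> real" where
  "trop_term s h k t \<delta> x =
     h (route_R s k t \<delta>) + (\<Sum>i\<in>{1..<k}. real (\<delta> i) * Poly_Mapping.lookup x i)"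

definition trop_poly ::
  "nat list \<Rightarrow> (edge list \<Rightarrow> real) \<Rightarrow> nat \<Rightarrow> nat \<Rightarrow> (nat \<Rightarrow>\<^sub>0 real) \<Rightarrow> real" where
  "trop_poly s h k t x = Min ((\<lambda>\<delta>. trop_term s h k t \<delta> x) ` cube k)"

definition minimizers ::
  "nat list \<Rightarrow> (edge list \<Rightarrow> real) \<Rightarrow> nat \<Rightarrow> nat \<Rightarrow> (nat \<Rightarrow>\<^sub>0 real) \<Rightarrow> (nat \<Rightarrow> nat) set" where
  "minimizers s h k t x = {\<delta> \<in> cube k. trop_term s h k t \<delta> x = trop_poly s h k t x}"

definition Rn :: "nat \<Rightarrow> (nat \<Rightarrow>\<^sub>0 real) set" where
  "Rn n = {x. Poly_Mapping.keys x \<subseteq> {1..n}}"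

definition cell :: "nat list \<Rightarrow> (edge list \<Rightarrow> real) \<Rightarrow> (nat \<Rightarrow>\<^sub>0 real) \<Rightarrow> (nat \<Rightarrow>\<^sub>0 real) set" where
  "cell s h x = {y \<in> Rn (length s).
     \<forall>k\<in>{2..length s + 1}. \<forall>t\<in>{1..part s k - 1}. minimizers s h k t x \<subseteq> minimizers s h k t y}"

definition bounded_complex :: "nat list \<Rightarrow> (edge list \<Rightarrow> real) \<Rightarrow> (nat \<Rightarrow>\<^sub>0 real) set set" where
  "bounded_complex s h = {cell s h x | x. x \<in> Rn (length s) \<and> bounded (cell s h x)}"

definition edge_between :: "'v::real_vector set set \<Rightarrow> 'v \<Rightarrow> 'v \<Rightarrow> bool" where
  "edge_between K x y \<longleftrightarrow> x \<noteq> y \<and> {x} \<in> K \<and> {y} \<in> K \<and> closed_segment x y \<in> K"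


subsection \<open>Routes of prefixes and the vertices of the complex\<close>

definition route_level :: "nat list \<Rightarrow> nat list \<Rightarrow> nat" where
  "route_level s u =
     (LEAST c. c = length s + 1 \<or>
        (c \<in> {1..length s} \<and> 0 < count_list u c \<and> count_list u c < part s c))"

definition route :: "nat list \<Rightarrow> nat list \<Rightarrow> edge list" where
  "route s u =
     map (\<lambda>i. (i, if i = length s + 1 then 1 else count_list u i)) (rev [1..<route_level s u + 1])"

definition simplex_routes :: "nat list \<Rightarrow> nat list \<Rightarrow> edge list set" where
  "simplex_routes s w = {route s (take i w) | i. i \<le> length w}"

definition vert :: "nat list \<Rightarrow> (edge list \<Rightarrow> real) \<Rightarrow> nat list \<Rightarrow> (nat \<Rightarrow>\<^sub>0 real)" where
  "vert s h w = (THE x. x \<in> Rn (length s) \<and>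
     (\<forall>k\<in>{2..length s + 1}. \<forall>t\<in>{1..part s k - 1}. \<forall>\<delta>\<in>cube k.
        route_R s k t \<delta> \<in> simplex_routes s w \<longrightarrow> \<delta> \<in> minimizers s h k t x))"

end

theory Submission
  imports Defs
begin

text \<open>
  For a Stirling permutation \<open>w\<close>, the routes of the prefixes of \<open>w\<close> are pairwise coherent and use
  every source edge, so admissibility together with the Cayley trick yields a point whose
  minimizers are exactly these routes. If a factor \<open>B\<close> of \<open>w = pBq\<close> shares no letter with \<open>p\<close>
  and \<open>q\<close>, then \<open>route p\<close> and \<open>route (pB)\<close> start with the same source edge and differ exactly by
  the dips at the letters of \<open>B\<close>; hence the coordinates of the point indexed by the letters of \<open>B\<close>
  sum to \<open>h (route p) - h (route (pB))\<close>. For the blocks of all letters this is a triangular system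
  that determines the point. Transposing \<open>B\<^sub>a\<close> and \<open>c\<close> exchanges the route of \<open>u\<^sub>1B\<^sub>a\<close> for
  that of \<open>u\<^sub>1c\<close> and keeps all other routes; the equations of the common routes leave only the
  direction \<open>e\<^sub>a - e\<^sub>c\<close> free, and the two exchanged routes bound the segment.
\<close>

section \<open>Parts of a composition and coordinates of finitely supported functions\<close>

lemma part_pos: "composition s \<Longrightarrow> 1 \<le> i \<Longrightarrow> i \<le> length s + 1 \<Longrightarrow> 0 < part s i"
  by (cases "i = length s + 1") (auto simp: part_def composition_def nth_append)

lemma part_last [simp]: "part s (Suc (length s)) = 2"
  by (simp add: part_def)

lemma lookup_scaleR [simp]:
  "Poly_Mapping.lookup (r *\<^sub>R x) i = r *\<^sub>R Poly_Mapping.lookup x i"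
proof -
  have "finite {i. r *\<^sub>R Poly_Mapping.lookup x i \<noteq> 0}"
    by (rule finite_subset[OF _ finite_lookup[of x]]) auto
  then show ?thesis
    by (simp add: scaleR_poly_mapping_def lookup_Abs_poly_mapping)
qed

lemma linear_lookup: "linear (\<lambda>x. Poly_Mapping.lookup x i)"
  by (rule linearI) (simp_all add: lookup_add)

subsection \<open>Routes\<close>

text \<open>With \<open>k \<le> length s\<close> the start has nonnegative index, while source edges
  leave vertex -1. So only bumps and dips can be traversed, and each lowers the superscript by
  one.\<close>

lemma cas_from_inner:
  assumes "composition s" "set p \<subseteq> source_edges s \<union> bumps_dips s"
    "pre_digraph.cas (Gs s) (int (length s) - int k) p (int (length s))" "k \<le> length s"
  shows "map fst p = rev [1..<Suc k] \<and> set p \<inter> source_edges s = {}"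
  using assms(2-)
proof (induction p arbitrary: k)
  case Nil
  then show ?case by (simp add: pre_digraph.cas.simps)
next
  case (Cons e es)
  have t: "tail (Gs s) e = int (length s) - int k"
    and c: "pre_digraph.cas (Gs s) (int (length s) + 1 - int (fst e)) es (int (length s))"
    using Cons.prems by (simp_all add: pre_digraph.cas.simps) (simp add: Gs_def)
  have ns: "e \<notin> source_edges s" and fe: "fst e = k"
    using t Cons.prems(3) by (auto simp: Gs_def split: if_splits)
  have "1 \<le> k"
    using ns fe Cons.prems(1) by (auto simp: bumps_dips_def)
  then have "int (length s) + 1 - int (fst e) = int (length s) - int (k - 1)"
    using fe by linarith
  then have "map fst es = rev [1..<Suc (k - 1)] \<and> set es \<inter> source_edges s = {}"
    using c Cons.prems(1,3) by (intro Cons.IH) (simp_all only: set_simps, auto)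
  then show ?case
    using ns fe \<open>1 \<le> k\<close> by simp
qed

text \<open>Only source edges leave vertex -1, and after the first edge the walk is at an inner
  vertex or at the sink. Hence the first superscript equals the length of the route.\<close>

lemma route_shape:
  assumes "composition s" "p \<in> routes s"
  shows "p \<noteq> []" "map fst p = rev [1..<Suc (length p)]"
    "hd p \<in> source_edges s" "set (tl p) \<inter> source_edges s = {}"
proof -
  have aw: "set p \<subseteq> source_edges s \<union> bumps_dips s"
    "pre_digraph.cas (Gs s) (-1) p (int (length s))"
    using assms(2) by (auto simp: routes_def pre_digraph.awalk_def Gs_def)
  then show "p \<noteq> []" by (auto simp: pre_digraph.cas.simps)
  then obtain e es where p: "p = e # es" by (cases p) auto
  have "tail (Gs s) e = -1"
    using aw p by (simp add: pre_digraph.cas.simps)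
  then have se: "e \<in> source_edges s"
    using aw(1) p by (auto simp: Gs_def bumps_dips_def split: if_splits)
  then have k: "1 \<le> fst e" "fst e \<le> length s + 1" by (auto simp: source_edges_def)
  have "pre_digraph.cas (Gs s) (int (length s) + 1 - int (fst e)) es (int (length s))"
    using aw p by (simp add: pre_digraph.cas.simps) (simp add: Gs_def)
  moreover have "int (length s) + 1 - int (fst e) = int (length s) - int (fst e - 1)"
    using k by linarith
  ultimately have *: "map fst es = rev [1..<Suc (fst e - 1)] \<and> set es \<inter> source_edges s = {}"
    using cas_from_inner[OF assms(1), of es "fst e - 1"] aw(1) p k by simp
  then have "length (map fst es) = length (rev [1..<Suc (fst e - 1)])" by (simp only:)
  then have "length es = fst e - 1" by (simp del: upt_Suc)
  then show "map fst p = rev [1..<Suc (length p)]"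
    using p * k by simp
  show "hd p \<in> source_edges s" "set (tl p) \<inter> source_edges s = {}"
    using p se * by auto
qed

text \<open>The source edge of \<open>P\<close> must be the only source edge of \<open>Q\<close>,
  which makes the lengths equal; then each superscript occurs exactly once in \<open>Q\<close>.
  Routes thus form an antichain of edge sets.\<close>

lemma route_eqI_subset:
  assumes "composition s" "P \<in> routes s" "Q \<in> routes s" "set P \<subseteq> set Q"
  shows "P = Q"
proof -
  note P = route_shape[OF assms(1,2)] and Q = route_shape[OF assms(1,3)]
  have "hd P \<in> set Q" using P(1) assms(4) by auto
  then have "hd P = hd Q"
    using P(3) Q(1,4) by (cases Q) auto
  moreover have "length R = fst (hd R)" if "R \<noteq> []" "map fst R = rev [1..<Suc (length R)]"
    for R :: "edge list"
    using that by (cases R) auto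
  ultimately have len: "length P = length Q"
    using P(1,2) Q(1,2) by metis
  then have m: "map fst P = map fst Q" using P(2) Q(2) by simp
  have "distinct (map fst Q)" unfolding Q(2) by simp
  then have inj: "inj_on fst (set Q)" by (simp add: distinct_map)
  show ?thesis
  proof (rule nth_equalityI[OF len])
    fix i assume i: "i < length P"
    have "P ! i \<in> set Q" "Q ! i \<in> set Q" using i len assms(4) by auto
    moreover have "fst (P ! i) = fst (Q ! i)"
      using m i len by (metis nth_map)
    ultimately show "P ! i = Q ! i" using inj by (auto dest: inj_onD)
  qed
qed

lemma cubeD: "\<delta> \<in> cube k \<Longrightarrow> 1 \<le> i \<Longrightarrow> i < k \<Longrightarrow> \<delta> i = 0 \<or> \<delta> i = 1"
  by (auto simp: cube_def PiE_iff)

lemma finite_cube: "finite (cube k)"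
  by (simp add: cube_def finite_PiE)

lemma cas_bumps_dips:
  assumes "composition s" "k \<le> length s" "\<And>i. 1 \<le> i \<Longrightarrow> i \<le> k \<Longrightarrow> f i = 0 \<or> f i = part s i"
  shows "pre_digraph.cas (Gs s) (int (length s) - int k)
    (map (\<lambda>i. (i, f i)) (rev [1..<Suc k])) (int (length s))"
  using assms(2,3)
proof (induction k)
  case 0
  then show ?case by (simp add: pre_digraph.cas.simps)
next
  case (Suc k)
  have "f (Suc k) = 0 \<or> f (Suc k) = part s (Suc k)" using Suc.prems(2)[of "Suc k"] by simp
  then have "(Suc k, f (Suc k)) \<notin> source_edges s"
    using part_pos[OF assms(1), of "Suc k"] Suc.prems(1) by (auto simp: source_edges_def)
  then have "tail (Gs s) (Suc k, f (Suc k)) = int (length s) - int (Suc k)"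
    and "head (Gs s) (Suc k, f (Suc k)) = int (length s) - int k"
    by (simp_all add: Gs_def)
  then show ?case using Suc by (simp add: pre_digraph.cas.simps)
qed

lemma route_R_in_routes:
  assumes "composition s" "k \<in> {1..length s + 1}" "t \<in> {1..part s k - 1}" "\<delta> \<in> cube k"
  shows "route_R s k t \<delta> \<in> routes s"
proof -
  have d: "\<delta> i * part s i = 0 \<or> \<delta> i * part s i = part s i" if "1 \<le> i" "i < k" for i
    using cubeD[OF assms(4) that] by auto
  have kt: "(k, t) \<in> source_edges s" using assms by (auto simp: source_edges_def)
  have sub: "set (map (\<lambda>i. (i, \<delta> i * part s i)) (rev [1..<k])) \<subseteq> bumps_dips s"
    using d assms(2) by (force simp: bumps_dips_def)
  have "pre_digraph.cas (Gs s) (int (length s) - int (k - 1))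
      (map (\<lambda>i. (i, \<delta> i * part s i)) (rev [1..<Suc (k - 1)])) (int (length s))"
    using assms d by (intro cas_bumps_dips) auto
  moreover have "Suc (k - 1) = k" "int (length s) + 1 - int k = int (length s) - int (k - 1)"
    using assms(2) by (auto simp: algebra_simps)
  ultimately have "pre_digraph.cas (Gs s) (int (length s) + 1 - int k)
      (map (\<lambda>i. (i, \<delta> i * part s i)) (rev [1..<k])) (int (length s))"
    by metis
  then have "pre_digraph.cas (Gs s) (-1) (route_R s k t \<delta>) (int (length s))"
    using kt by (simp add: route_R_def pre_digraph.cas.simps) (simp add: Gs_def)
  moreover have "set (route_R s k t \<delta>) \<subseteq> arcs (Gs s)" "-1 \<in> verts (Gs s)"
    using sub kt by (auto simp: route_R_def Gs_def)
  ultimately show ?thesis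
    by (simp add: routes_def pre_digraph.awalk_def)
qed

subsection \<open>Height functions certifying a set of coherent routes\<close>

text \<open>Strictness survives as soon as one point with positive weight lies in the open
  half-space. Unlike the closed half-space, this set meets the bounding hyperplane only in
  \<open>p\<close>.\<close>

lemma convex_open_halfspace_insert:
  fixes \<psi> :: "'v::real_vector \<Rightarrow> real"
  assumes "linear \<psi>"
  shows "convex (insert p {q. \<psi> q < \<psi> p})"
proof (rule convexI)
  fix x y and u v :: real
  assume *: "x \<in> insert p {q. \<psi> q < \<psi> p}" "y \<in> insert p {q. \<psi> q < \<psi> p}"
    "0 \<le> u" "0 \<le> v" "u + v = 1"
  have lin: "\<psi> (u *\<^sub>R x + v *\<^sub>R y) = u * \<psi> x + v * \<psi> y"
    using assms by (simp add: linear_add linear_scale)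
  have pp: "u *\<^sub>R p + v *\<^sub>R p = p" "u * \<psi> p + v * \<psi> p = \<psi> p"
    using *(5) by (simp_all flip: scaleR_add_left distrib_right)
  show "u *\<^sub>R x + v *\<^sub>R y \<in> insert p {q. \<psi> q < \<psi> p}"
  proof (cases "u = 0 \<or> v = 0 \<or> (x = p \<and> y = p)")
    case True
    then show ?thesis using * pp by auto
  next
    case False
    then have "0 < u" "0 < v" "\<psi> x \<le> \<psi> p" "\<psi> y \<le> \<psi> p" "\<psi> x < \<psi> p \<or> \<psi> y < \<psi> p"
      using * by auto
    then have "u * \<psi> x + v * \<psi> y < u * \<psi> p + v * \<psi> p"
      by (meson add_le_less_mono add_less_le_mono mult_left_mono mult_strict_left_mono less_imp_le)
    then show ?thesis using lin pp by simp
  qed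
qed

lemma lookup_indicator_vec: "Poly_Mapping.lookup (indicator_vec R) e = (if e \<in> set R then 1 else 0)"
  by (simp add: indicator_vec_def lookup_sum lookup_single when_def)

text \<open>The linear functional that exposes \<open>indicator_vec R\<close> among the indicator
  vectors of routes.\<close>

definition overlap :: "edge list \<Rightarrow> (edge \<Rightarrow>\<^sub>0 real) \<Rightarrow> real" where
  "overlap R x = (\<Sum>e\<in>set R. Poly_Mapping.lookup x e)"

lemma linear_overlap: "linear (overlap R)"
  unfolding overlap_def by (intro linear_compose_sum ballI linear_lookup)

lemma overlap_indicator_vec: "overlap R (indicator_vec Q) = card (set R \<inter> set Q)"
  by (simp add: overlap_def lookup_indicator_vec sum.If_cases)

lemma overlap_less:
  assumes "composition s" "P \<in> routes s" "Q \<in> routes s" "P \<noteq> Q"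
  shows "overlap P (indicator_vec Q) < overlap P (indicator_vec P)"
proof -
  have "\<not> set P \<subseteq> set Q" using route_eqI_subset assms by blast
  then have "set P \<inter> set Q \<subset> set P" by blast
  then show ?thesis
    by (simp add: overlap_indicator_vec psubset_card_mono)
qed

text \<open>If \<open>R\<close> were missing, \<open>overlap R\<close> would be strictly below its
  value at \<open>R\<close> on all generators, hence on the hull. A set of routes can therefore be
  recovered from its convex hull.\<close>

lemma indicator_vec_in_hull:
  assumes "composition s" "C \<subseteq> routes s" "R \<in> routes s"
    "indicator_vec R \<in> convex hull (indicator_vec ` C)"
  shows "R \<in> C"
proof (rule ccontr)
  assume "R \<notin> C"
  let ?S = "{v. overlap R v < overlap R (indicator_vec R)}"
  have "convex ?S"
    using convex_linear_vimage[OF linear_overlap convex_real_interval(4), of R]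
    by (simp add: vimage_def)
  moreover have "indicator_vec ` C \<subseteq> ?S"
    using overlap_less[OF assms(1,3)] assms(2) \<open>R \<notin> C\<close> by blast
  ultimately have "convex hull (indicator_vec ` C) \<subseteq> ?S" by (intro hull_minimal)
  then show False using assms(4) by auto
qed

text \<open>The lifted polytope has a single point over the indicator vector of a route: all other
  generators lie strictly below the hyperplane given by \<open>overlap R\<close>.\<close>

lemma lifted_indicator_vec_in_hull:
  assumes "composition s" "R \<in> routes s"
    "(indicator_vec R, y) \<in> convex hull ((\<lambda>R. (indicator_vec R, h R)) ` routes s)"
  shows "y = h R"
proof -
  let ?\<psi> = "overlap R \<circ> fst" and ?p = "(indicator_vec R, h R)"
  let ?S = "insert ?p {q. ?\<psi> q < ?\<psi> ?p}"
  have "linear ?\<psi>"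
    by (intro linear_compose linear_fst linear_overlap)
  then have "convex ?S" by (rule convex_open_halfspace_insert)
  moreover have "(\<lambda>R. (indicator_vec R, h R)) ` routes s \<subseteq> ?S"
  proof (rule image_subsetI)
    fix Q assume "Q \<in> routes s"
    then show "(indicator_vec Q, h Q) \<in> ?S"
      using overlap_less[OF assms(1,2)] by (cases "R = Q") simp_all
  qed
  ultimately have "convex hull ((\<lambda>R. (indicator_vec R, h R)) ` routes s) \<subseteq> ?S"
    by (intro hull_minimal)
  then show ?thesis using assms(3) by auto
qed

text \<open>The simplex of \<open>C\<close> is the projection of a lower face; \<phi> is the
  functional defining that face and \<open>m\<close> its minimum. Single-point fibres put the lifted
  routes of \<open>C\<close> into the face, and \<open>indicator_vec_in_hull\<close> keeps the
  others out.\<close>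

lemma admissible_certificate:
  assumes "composition s" "admissible s h" "C \<noteq> {}" "C \<subseteq> routes s"
    "\<And>P Q. P \<in> C \<Longrightarrow> Q \<in> C \<Longrightarrow> coherent s P Q"
  shows "\<exists>\<phi> m. linear \<phi> \<and> (\<forall>R\<in>routes s. m \<le> \<phi> (indicator_vec R) + h R \<and>
    (\<phi> (indicator_vec R) + h R = m \<longleftrightarrow> R \<in> C))"
proof -
  let ?P = "convex hull ((\<lambda>R. (indicator_vec R, h R)) ` routes s)"
  have "convex hull (indicator_vec ` C) \<in> DKK s"
    unfolding DKK_def using assms(3-) by blast
  then obtain F where F: "F \<in> lower_faces ?P" "fst ` F = convex hull (indicator_vec ` C)"
    using assms(2) unfolding admissible_def by (metis (no_types, lifting) imageE)
  then obtain \<phi> where \<phi>: "linear \<phi>"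
    and Feq: "F = {p \<in> ?P. \<forall>q\<in>?P. \<phi> (fst p) + snd p \<le> \<phi> (fst q) + snd q}"
    unfolding lower_faces_def by blast
  have inP: "(indicator_vec R, h R) \<in> ?P" if "R \<in> routes s" for R
    using that by (intro hull_inc) auto
  have inF: "(indicator_vec R, h R) \<in> F" if R: "R \<in> C" for R
  proof -
    have "indicator_vec R \<in> fst ` F" unfolding F(2) using R by (intro hull_inc) auto
    then obtain y where y: "(indicator_vec R, y) \<in> F" by force
    then have "y = h R"
      using lifted_indicator_vec_in_hull[OF assms(1), of R y h] R assms(4) Feq by blast
    then show ?thesis using y by simp
  qed
  obtain R0 where R0: "R0 \<in> C" using assms(3) by blast
  let ?m = "\<phi> (indicator_vec R0) + h R0"
  have le: "?m \<le> \<phi> (indicator_vec R) + h R" if "R \<in> routes s" for R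
    using inF[OF R0] inP[OF that] unfolding Feq by auto
  have "R \<in> C" if R: "R \<in> routes s" and eq: "\<phi> (indicator_vec R) + h R = ?m" for R
  proof -
    have "(indicator_vec R, h R) \<in> F"
      using inF[OF R0] inP[OF R] eq unfolding Feq by auto
    then have "indicator_vec R \<in> convex hull (indicator_vec ` C)"
      using F(2) by force
    then show ?thesis using indicator_vec_in_hull assms R by blast
  qed
  moreover have "\<phi> (indicator_vec R) + h R = ?m" if R: "R \<in> C" for R
  proof (rule antisym)
    show "\<phi> (indicator_vec R) + h R \<le> ?m"
      using inF[OF R] inP[of R0] R0 assms(4) unfolding Feq by fastforce
  qed (use le R assms(4) in blast)
  ultimately show ?thesis
    using \<phi> le by (intro exI[of _ \<phi>] exI[of _ ?m]) blast
qed

section \<open>Minimizers of the tropical polynomials and the Cayley trick\<close>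

lemma minimizers_iff:
  "\<delta> \<in> minimizers s h k t x \<longleftrightarrow>
    \<delta> \<in> cube k \<and> (\<forall>\<epsilon>\<in>cube k. trop_term s h k t \<delta> x \<le> trop_term s h k t \<epsilon> x)"
proof (cases "\<delta> \<in> cube k")
  case True
  have "finite ((\<lambda>\<delta>. trop_term s h k t \<delta> x) ` cube k)"
    by (intro finite_imageI finite_cube)
  then have "trop_poly s h k t x = trop_term s h k t \<delta> x \<longleftrightarrow>
      (\<forall>\<epsilon>\<in>cube k. trop_term s h k t \<delta> x \<le> trop_term s h k t \<epsilon> x)"
    unfolding trop_poly_def using True by (subst Min_eq_iff) auto
  then show ?thesis using True by (auto simp: minimizers_def)
qed (simp add: minimizers_def)

text \<open>Since \<delta> takes only the values 0 and 1, the contribution of the edge chosen at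
  \<open>i\<close> is affine in \<open>\<delta> i\<close>.\<close>

lemma sum_route_R:
  assumes "k \<ge> 1" "\<delta> \<in> cube k"
  shows "(\<Sum>e\<in>set (route_R s k t \<delta>). f e) = (f (k, t) + (\<Sum>i\<in>{1..<k}. f (i, 0)))
    + (\<Sum>i\<in>{1..<k}. real (\<delta> i) * (f (i, part s i) - f (i, 0)))"
proof -
  have "set (route_R s k t \<delta>) = insert (k, t) ((\<lambda>i. (i, \<delta> i * part s i)) ` {1..<k})"
    by (simp add: route_R_def)
  moreover have "(k, t) \<notin> (\<lambda>i. (i, \<delta> i * part s i)) ` {1..<k}" by auto
  ultimately have "(\<Sum>e\<in>set (route_R s k t \<delta>). f e)
      = f (k, t) + (\<Sum>i\<in>{1..<k}. f (i, \<delta> i * part s i))"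
    by (simp add: sum.reindex inj_on_def)
  also have "(\<Sum>i\<in>{1..<k}. f (i, \<delta> i * part s i))
      = (\<Sum>i\<in>{1..<k}. f (i, 0) + real (\<delta> i) * (f (i, part s i) - f (i, 0)))"
  proof (rule sum.cong[OF refl])
    fix i assume "i \<in> {1..<k}"
    then have "\<delta> i = 0 \<or> \<delta> i = 1" using cubeD[OF assms(2)] by simp
    then show "f (i, \<delta> i * part s i) = f (i, 0) + real (\<delta> i) * (f (i, part s i) - f (i, 0))"
      by auto
  qed
  finally show ?thesis by (simp add: sum.distrib)
qed

text \<open>
  Cayley trick: up to a constant depending only on the source edge, a functional on the flow
  polytope evaluates \<open>R(k, t, \<delta>)\<close> to \<open>\<Sum> \<delta>\<^sub>i x\<^sub>i\<close>, where \<open>x\<^sub>i\<close> is the difference of its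
  values at the dip and the bump.
\<close>

lemma admissible_point:
  assumes "composition s" "admissible s h" "C \<subseteq> routes s"
    "\<And>P Q. P \<in> C \<Longrightarrow> Q \<in> C \<Longrightarrow> coherent s P Q"
    and cover: "\<And>k t. k \<in> {2..length s + 1} \<Longrightarrow> t \<in> {1..part s k - 1} \<Longrightarrow>
      \<exists>\<delta>\<in>cube k. route_R s k t \<delta> \<in> C"
  shows "\<exists>x\<in>Rn (length s). \<forall>k\<in>{2..length s + 1}. \<forall>t\<in>{1..part s k - 1}.
    minimizers s h k t x = {\<delta> \<in> cube k. route_R s k t \<delta> \<in> C}"
\<comment> \<open>The certificate requires a nonempty set. If \<open>C\<close> is empty,
  \<open>cover\<close> leaves no pair \<open>(k, t)\<close> to check, and the origin serves.\<close>
proof (cases "C = {}")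
  case True
  have "minimizers s h k t 0 = {\<delta> \<in> cube k. route_R s k t \<delta> \<in> C}"
    if "k \<in> {2..length s + 1}" "t \<in> {1..part s k - 1}" for k t
    using cover[OF that] True by simp
  then show ?thesis by (intro bexI[of _ 0]) (simp_all add: Rn_def)
next
  case False
  obtain \<phi> m where \<phi>: "linear \<phi>"
    and le: "\<And>R. R \<in> routes s \<Longrightarrow> m \<le> \<phi> (indicator_vec R) + h R"
    and eq: "\<And>R. R \<in> routes s \<Longrightarrow> \<phi> (indicator_vec R) + h R = m \<longleftrightarrow> R \<in> C"
    using admissible_certificate[OF assms(1,2) False assms(3,4)] by auto
  define f where "f = (\<lambda>e. \<phi> (Poly_Mapping.single e 1))"
  define x where "x = (\<Sum>i\<in>{1..length s}. Poly_Mapping.single i (f (i, part s i) - f (i, 0)))"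
  have lx: "Poly_Mapping.lookup x i = (if i \<in> {1..length s} then f (i, part s i) - f (i, 0) else 0)" for i
    by (simp add: x_def lookup_sum lookup_single when_def)
  have "x \<in> Rn (length s)"
    by (auto simp: Rn_def lx in_keys_iff split: if_splits)
  moreover have "minimizers s h k t x = {\<delta> \<in> cube k. route_R s k t \<delta> \<in> C}"
    if k: "k \<in> {2..length s + 1}" and t: "t \<in> {1..part s k - 1}" for k t
  proof -
    let ?K = "f (k, t) + (\<Sum>i\<in>{1..<k}. f (i, 0))"
    have tt: "\<phi> (indicator_vec (route_R s k t \<delta>)) + h (route_R s k t \<delta>)
        = trop_term s h k t \<delta> x + ?K" if "\<delta> \<in> cube k" for \<delta>
    proof -
      have "\<phi> (indicator_vec (route_R s k t \<delta>)) = (\<Sum>e\<in>set (route_R s k t \<delta>). f e)"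
        using \<phi> by (simp add: indicator_vec_def linear_sum f_def)
      also have "\<dots> = ?K + (\<Sum>i\<in>{1..<k}. real (\<delta> i) * (f (i, part s i) - f (i, 0)))"
        using k that by (intro sum_route_R) auto
      also have "(\<Sum>i\<in>{1..<k}. real (\<delta> i) * (f (i, part s i) - f (i, 0)))
          = (\<Sum>i\<in>{1..<k}. real (\<delta> i) * Poly_Mapping.lookup x i)"
        using k by (intro sum.cong refl) (auto simp: lx)
      finally show ?thesis by (simp add: trop_term_def)
    qed
    have R: "route_R s k t \<delta> \<in> routes s" if "\<delta> \<in> cube k" for \<delta>
      using route_R_in_routes[OF assms(1) _ t that] k by auto
    \<comment> \<open>By \<open>cover\<close> the global minimum \<open>m\<close> is attained by a
      route through this source edge, so the minimum over the cube is \<open>m\<close> minus the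
      constant \<open>?K\<close>.\<close>
    obtain \<delta>0 where d0: "\<delta>0 \<in> cube k" "route_R s k t \<delta>0 \<in> C" using cover[OF k t] by blast
    have m0: "m = trop_term s h k t \<delta>0 x + ?K"
      using eq[OF R[OF d0(1)]] d0 tt by simp
    have ge: "m \<le> trop_term s h k t \<delta> x + ?K" if "\<delta> \<in> cube k" for \<delta>
      using le[OF R[OF that]] tt[OF that] by simp
    have iff: "trop_term s h k t \<delta> x + ?K = m \<longleftrightarrow> route_R s k t \<delta> \<in> C" if "\<delta> \<in> cube k" for \<delta>
      using eq[OF R[OF that]] tt[OF that] by simp
    have "\<delta> \<in> minimizers s h k t x \<longleftrightarrow> route_R s k t \<delta> \<in> C" if d: "\<delta> \<in> cube k" for \<delta>
    proof -
      have "\<delta> \<in> minimizers s h k t x \<longleftrightarrow> trop_term s h k t \<delta> x + ?K = m"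
      proof
        assume "\<delta> \<in> minimizers s h k t x"
        then have "trop_term s h k t \<delta> x \<le> trop_term s h k t \<delta>0 x"
          using d0(1) by (simp add: minimizers_iff)
        then show "trop_term s h k t \<delta> x + ?K = m" using ge[OF d] m0 by linarith
      next
        assume e: "trop_term s h k t \<delta> x + ?K = m"
        have "trop_term s h k t \<delta> x \<le> trop_term s h k t \<epsilon> x" if "\<epsilon> \<in> cube k" for \<epsilon>
          using ge[OF that] e by linarith
        then show "\<delta> \<in> minimizers s h k t x" using d by (simp add: minimizers_iff)
      qed
      then show ?thesis using iff[OF d] by blast
    qed
    then show ?thesis by (auto simp: minimizers_iff)
  qed
  ultimately show ?thesis by blast
qed

subsection \<open>Prefixes of Stirling permutations\<close>

definition partial_letter :: "nat list \<Rightarrow> nat list \<Rightarrow> nat \<Rightarrow> bool" where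
  "partial_letter s u i \<longleftrightarrow> i \<in> {1..length s} \<and> 0 < count_list u i \<and> count_list u i < part s i"

text \<open>The subscript of the source edge with which \<open>route s u\<close> starts; at the
  default level n+1 it is 1 by convention.\<close>

definition level_mult :: "nat list \<Rightarrow> nat list \<Rightarrow> nat" where
  "level_mult s u = (if route_level s u = length s + 1 then 1 else count_list u (route_level s u))"

text \<open>The vector \<delta> of the route of a prefix: below the level every letter is absent or
  complete, so membership decides between bump and dip. The restriction gives an extensional
  function, as \<open>cube\<close> demands.\<close>

definition dips :: "nat list \<Rightarrow> nat list \<Rightarrow> nat \<Rightarrow> nat" where
  "dips s u = restrict (\<lambda>i. if i \<in> set u then 1 else 0) {1..<route_level s u}"

lemma dips_in_cube: "dips s u \<in> cube (route_level s u)"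
  by (auto simp: dips_def cube_def PiE_iff)

lemma route_level_eq_LEAST: "route_level s u = (LEAST c. c = length s + 1 \<or> partial_letter s u c)"
  by (simp add: route_level_def partial_letter_def)

lemma route_level_cases: "route_level s u = length s + 1 \<or> partial_letter s u (route_level s u)"
  unfolding route_level_eq_LEAST by (rule LeastI[of _ "length s + 1"]) simp

lemma route_level_bounds: "1 \<le> route_level s u" "route_level s u \<le> length s + 1"
  using route_level_cases[of s u] by (auto simp: partial_letter_def)

lemma not_partial_below_level: "i < route_level s u \<Longrightarrow> \<not> partial_letter s u i"
  unfolding route_level_eq_LEAST by (auto dest: not_less_Least)

lemma route_level_eqI:
  assumes "k = length s + 1 \<or> partial_letter s u k" "\<And>i. partial_letter s u i \<Longrightarrow> k \<le> i"
  shows "route_level s u = k"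
proof (rule antisym)
  show "route_level s u \<le> k"
    unfolding route_level_eq_LEAST using assms(1) by (rule Least_le)
  show "k \<le> route_level s u"
    using route_level_cases[of s u] assms by (auto simp: partial_letter_def)
qed

lemma less_route_levelI:
  assumes "k \<le> length s" "\<And>i. partial_letter s u i \<Longrightarrow> k < i"
  shows "k < route_level s u"
  using route_level_cases[of s u] assms by auto

lemma level_mult_range: "level_mult s u \<in> {1..part s (route_level s u) - 1}"
  using route_level_cases[of s u] by (auto simp: level_mult_def partial_letter_def)

lemma count_list_split:
  assumes "stirling_perm s (p @ q)" "i \<in> {1..length s}"
  shows "count_list p i + count_list q i = part s i"
  using assms by (simp add: stirling_perm_def)

text \<open>The occurrences on the two sides add up to the part, so a count is strictly between the
  extremes exactly when both sides contribute.\<close>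

lemma partial_letter_split:
  assumes "stirling_perm s (p @ q)"
  shows "partial_letter s p i \<longleftrightarrow> i \<in> set p \<and> i \<in> set q"
proof (cases "i \<in> {1..length s}")
  case True
  then show ?thesis
    using count_list_split[OF assms True] count_list_0_iff[of p i] count_list_0_iff[of q i]
    by (auto simp: partial_letter_def)
next
  case False
  then show ?thesis
    using assms by (auto simp: partial_letter_def stirling_perm_def)
qed

text \<open>The form in which avoidance of 121 is used from here on.\<close>

lemma stirling_between_le:
  assumes "stirling_perm s (p @ q @ r)" "x \<in> set p" "x \<in> set r" "y \<in> set q"
  shows "y \<le> x"
proof (rule ccontr)
  assume "\<not> y \<le> x"
  obtain i where i: "i < length p" "p ! i = x" using assms(2) by (auto simp: in_set_conv_nth)
  obtain j where j: "j < length q" "q ! j = y" using assms(4) by (auto simp: in_set_conv_nth)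
  obtain k where k: "k < length r" "r ! k = x" using assms(3) by (auto simp: in_set_conv_nth)
  let ?w = "p @ q @ r" and ?j = "length p + j" and ?k = "length p + length q + k"
  have "i < ?j" "?j < ?k" "?k < length ?w" "?w ! i = x" "?w ! ?j = y" "?w ! ?k = x"
    using i j k by (auto simp: nth_append)
  then have "\<not> avoids_121 ?w"
    unfolding avoids_121_def using \<open>\<not> y \<le> x\<close> by (metis not_le)
  then show False using assms(1) by (simp add: stirling_perm_def)
qed

text \<open>Below the level no letter is divided between \<open>p\<close> and \<open>q\<close>, so
  all its copies lie on one side.\<close>

lemma count_below_level:
  assumes "stirling_perm s (p @ q)" "1 \<le> i" "i < route_level s p"
  shows "count_list p i = dips s p i * part s i"
proof -
  have i: "i \<in> {1..length s}" using assms(2,3) route_level_bounds(2)[of s p] by auto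
  have "i \<notin> set p \<or> i \<notin> set q"
    using not_partial_below_level[OF assms(3)] partial_letter_split[OF assms(1)] by blast
  then show ?thesis
    using count_list_split[OF assms(1) i] count_list_0_iff[of p i] count_list_0_iff[of q i] assms(2,3)
    by (auto simp: dips_def)
qed

text \<open>Links the routes of prefixes to the terms of the tropical polynomials.\<close>

lemma route_eq_route_R:
  assumes "stirling_perm s (p @ q)"
  shows "route s p = route_R s (route_level s p) (level_mult s p) (dips s p)"
proof -
  let ?k = "route_level s p"
  have "[1..<?k + 1] = [1..<?k] @ [?k]" using route_level_bounds(1)[of s p] by simp
  moreover have "map (\<lambda>i. (i, if i = length s + 1 then 1 else count_list p i)) (rev [1..<?k])
      = map (\<lambda>i. (i, dips s p i * part s i)) (rev [1..<?k])"
    using count_below_level[OF assms] route_level_bounds(2)[of s p]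
    by (intro map_cong refl) auto
  ultimately show ?thesis
    unfolding route_def route_R_def by (simp add: level_mult_def)
qed

lemma route_in_routes:
  assumes "composition s" "stirling_perm s (p @ q)"
  shows "route s p \<in> routes s"
  unfolding route_eq_route_R[OF assms(2)]
  using route_level_bounds[of s p] level_mult_range[of s p] dips_in_cube[of s p]
  by (intro route_R_in_routes assms(1)) auto

lemma simplex_routes_iff:
  "R \<in> simplex_routes s w \<longleftrightarrow> (\<exists>p q. w = p @ q \<and> R = route s p)"
proof
  assume "R \<in> simplex_routes s w"
  then show "\<exists>p q. w = p @ q \<and> R = route s p"
    unfolding simplex_routes_def by (auto intro: append_take_drop_id[symmetric])
next
  assume "\<exists>p q. w = p @ q \<and> R = route s p"
  then obtain p q where "w = p @ q" "R = route s p" by blast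
  then have "R = route s (take (length p) w)" "length p \<le> length w" by simp_all
  then show "R \<in> simplex_routes s w" unfolding simplex_routes_def by blast
qed

subsection \<open>Coherence of the routes of a Stirling permutation\<close>

text \<open>The paths already differ in their last edges, so the common end \<open>Z\<close> in the
  definition is empty.\<close>

lemma initial_less_iff:
  assumes "P \<noteq> []" "Q \<noteq> []" "last P \<noteq> last Q" "head (Gs s) (last P) = head (Gs s) (last Q)"
  shows "initial_less s P Q \<longleftrightarrow> framing_less (last P) (last Q)"
proof
  assume "initial_less s P Q"
  then obtain P' Q' e f Z where *: "P = P' @ e # Z" "Q = Q' @ f # Z" "framing_less e f"
    unfolding initial_less_def by blast
  then have "Z = []" using assms(3) by (cases "Z = []") auto
  then show "framing_less (last P) (last Q)" using * by simp
next
  assume "framing_less (last P) (last Q)"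
  moreover have "P = butlast P @ last P # []" "Q = butlast Q @ last Q # []" using assms by simp_all
  ultimately show "initial_less s P Q" unfolding initial_less_def using assms(3,4) by blast
qed

lemma final_less_iff:
  assumes "P \<noteq> []" "Q \<noteq> []" "hd P \<noteq> hd Q" "tail (Gs s) (hd P) = tail (Gs s) (hd Q)"
  shows "final_less s P Q \<longleftrightarrow> framing_less (hd P) (hd Q)"
proof
  assume "final_less s P Q"
  then obtain P' Q' e f Z where *: "P = Z @ e # P'" "Q = Z @ f # Q'" "framing_less e f"
    unfolding final_less_def by blast
  then have "Z = []" using assms(3) by (cases Z) auto
  then show "framing_less (hd P) (hd Q)" using * by simp
next
  assume "framing_less (hd P) (hd Q)"
  moreover have "P = [] @ hd P # tl P" "Q = [] @ hd Q # tl Q" using assms by simp_all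
  ultimately show "final_less s P Q" unfolding final_less_def using assms(3,4) by blast
qed

text \<open>Superscripts descend to 1, so the superscript of an edge can be read off from the length
  of the path after it.\<close>

lemma route_entry:
  assumes "route s p = A @ e # S"
  shows "e = (Suc (length S), if Suc (length S) = length s + 1 then 1 else count_list p (Suc (length S)))"
    and "Suc (length S) \<le> route_level s p"
proof -
  have len: "length (route s p) = route_level s p" by (simp add: route_def)
  then have "length A + Suc (length S) = route_level s p" using assms by simp
  then have l: "length A < route_level s p" "route_level s p - length A = Suc (length S)" by auto
  have "e = route s p ! length A" using assms by simp
  also have "\<dots> = (\<lambda>i. (i, if i = length s + 1 then 1 else count_list p i)) (route_level s p - length A)"
    using l(1) by (simp add: route_def rev_nth Suc_diff_Suc del: upt_Suc)
  finally show "e = (Suc (length S), if Suc (length S) = length s + 1 then 1 else count_list p (Suc (length S)))"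
    using l(2) by simp
  show "Suc (length S) \<le> route_level s p" using l by simp
qed

text \<open>At both ends of a maximal common subpath the framing order compares the counts of one
  letter in \<open>p\<close> and \<open>q\<close>. These counts differ, and by \<open>mono\<close>
  the same prefix has the smaller count at both ends.\<close>

lemma coherent_prefix_routes:
  assumes p: "stirling_perm s (p @ p')" and q: "stirling_perm s (q @ q')"
    and mono: "(\<forall>i. count_list p i \<le> count_list q i) \<or> (\<forall>i. count_list q i \<le> count_list p i)"
  shows "coherent s (route s p) (route s q)"
  unfolding coherent_def
proof (intro allI impI, elim conjE)
  fix P1 P2 Q1 Q2 M
  assume P: "route s p = P1 @ M @ P2" and Q: "route s q = Q1 @ M @ Q2"
    and ne: "P1 \<noteq> []" "P2 \<noteq> []" "Q1 \<noteq> []" "Q2 \<noteq> []"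
    and hd: "head (Gs s) (last P1) = head (Gs s) (last Q1)"
    and d: "last P1 \<noteq> last Q1" "hd P2 \<noteq> hd Q2"
  have e1: "route s p = butlast P1 @ last P1 # (M @ P2)" using P ne by simp
  have f1: "route s q = butlast Q1 @ last Q1 # (M @ Q2)" using Q ne by simp
  have e2: "route s p = (P1 @ M) @ hd P2 # tl P2" using P ne by simp
  have f2: "route s q = (Q1 @ M) @ hd Q2 # tl Q2" using Q ne by simp
  note e1 = route_entry[OF e1] and f1 = route_entry[OF f1]
  note e2 = route_entry[OF e2] and f2 = route_entry[OF f2]
  \<comment> \<open>A common head forces equal superscripts, which aligns the two occurrences of
    \<open>M\<close>.\<close>
  have "fst (last P1) = fst (last Q1)" using hd by (simp add: Gs_def)
  then have "length (M @ P2) = length (M @ Q2)" using e1(1) f1(1) by (metis fst_conv nat.inject)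
  then have len: "length P2 = length Q2" by simp
  define i where "i = Suc (length (M @ P2))"
  define j where "j = length P2"
  have j: "Suc (length (tl P2)) = j" "Suc (length (tl Q2)) = j" "1 \<le> j"
    using ne len by (auto simp: j_def Suc_le_eq)
  have i: "Suc (length (M @ Q2)) = i" using len by (simp add: i_def)
  have ji: "j < i" by (simp add: i_def j_def)
  have lev: "i \<le> route_level s p" "i \<le> route_level s q"
    using e1(2) f1(2) unfolding i by (simp_all add: i_def)
  then have jn: "j \<noteq> length s + 1" "j < route_level s p" "j < route_level s q"
    using ji route_level_bounds(2)[of s p] by auto
  have E1: "last P1 = (i, if i = length s + 1 then 1 else count_list p i)"
    using e1(1) unfolding i_def .
  have F1: "last Q1 = (i, if i = length s + 1 then 1 else count_list q i)"
    using f1(1) unfolding i .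
  have E2: "hd P2 = (j, count_list p j)" using e2(1) jn(1) unfolding j by simp
  have F2: "hd Q2 = (j, count_list q j)" using f2(1) jn(1) unfolding j by simp
  \<comment> \<open>The edges after \<open>M\<close> are bumps or dips with the same superscript and
    therefore have the same tail.\<close>
  have "(j, dips s u j * part s j) \<notin> source_edges s" if "j < route_level s u" for u
    using that j(3) by (auto simp: dips_def source_edges_def)
  then have "tail (Gs s) (hd P2) = tail (Gs s) (hd Q2)"
    unfolding E2 F2 count_below_level[OF p j(3) jn(2)] count_below_level[OF q j(3) jn(3)]
    using jn by (simp add: Gs_def)
  then have "final_less s P2 Q2 \<longleftrightarrow> count_list p j < count_list q j"
    using final_less_iff[of P2 Q2 s] ne d by (simp add: framing_less_def E2 F2)
  moreover have "initial_less s P1 Q1 \<longleftrightarrow> count_list p i < count_list q i"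
    using initial_less_iff[of P1 Q1 s] ne d hd E1 F1 by (simp add: framing_less_def split: if_splits)
  moreover have "count_list p i \<noteq> count_list q i" "count_list p j \<noteq> count_list q j"
    using d E1 F1 E2 F2 by (auto split: if_splits)
  ultimately show "initial_less s P1 Q1 \<longleftrightarrow> final_less s P2 Q2"
    using mono by (metis le_neq_implies_less not_less)
qed

lemma coherent_simplex_routes:
  assumes "stirling_perm s w" "P \<in> simplex_routes s w" "Q \<in> simplex_routes s w"
  shows "coherent s P Q"
proof -
  obtain p p' where p: "w = p @ p'" "P = route s p"
    using assms(2) unfolding simplex_routes_iff by blast
  obtain q q' where q: "w = q @ q'" "Q = route s q"
    using assms(3) unfolding simplex_routes_iff by blast
  have "p @ p' = q @ q'" using p q by simp
  then have "(\<exists>z. q = p @ z) \<or> (\<exists>z. p = q @ z)" by (auto simp: append_eq_append_conv2)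
  then have "(\<forall>i. count_list p i \<le> count_list q i) \<or> (\<forall>i. count_list q i \<le> count_list p i)"
    by auto
  then show ?thesis
    using coherent_prefix_routes assms(1) p q by metis
qed

subsection \<open>Blocks and the equations they impose\<close>

text \<open>No letter of \<open>B\<close> is unfinished before or after \<open>B\<close>, so the
  unfinished letters do not change. Each of them occurs on both sides of \<open>B\<close> and so
  exceeds all letters of \<open>B\<close> by avoidance of 121.\<close>

lemma closed_factor_level:
  assumes "stirling_perm s (p @ B @ q)" "set B \<inter> (set p \<union> set q) = {}"
  shows "route_level s (p @ B) = route_level s p" "level_mult s (p @ B) = level_mult s p"
    "set B \<subseteq> {1..<route_level s p}"
proof -
  have "stirling_perm s ((p @ B) @ q)" using assms(1) by simp
  note part1 = partial_letter_split[OF assms(1)] and part2 = partial_letter_split[OF this]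
  have eq: "partial_letter s (p @ B) = partial_letter s p"
    using part1 part2 assms(2) by (auto simp: fun_eq_iff)
  then show lev: "route_level s (p @ B) = route_level s p"
    by (simp add: route_level_eq_LEAST)
  have "route_level s p = length s + 1 \<or> route_level s p \<notin> set B"
    using route_level_cases[of s p] part1 assms(2) by blast
  then show "level_mult s (p @ B) = level_mult s p"
    unfolding level_mult_def lev by (auto simp: count_list_0_iff)
  show "set B \<subseteq> {1..<route_level s p}"
  proof
    fix b assume b: "b \<in> set B"
    then have range: "1 \<le> b" "b \<le> length s" using assms(1) by (auto simp: stirling_perm_def)
    have "b < i" if "partial_letter s p i" for i
    proof -
      have "i \<in> set p" "i \<in> set q" "i \<notin> set B" using that part1 part2 eq assms(2) by auto
      then have "b \<le> i" "b \<noteq> i" using stirling_between_le[OF assms(1)] b by auto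
      then show ?thesis by simp
    qed
    then show "b \<in> {1..<route_level s p}" using less_route_levelI[of b s p] range by simp
  qed
qed

text \<open>Both prefixes belong to the same tropical polynomial, and appending \<open>B\<close>
  turns exactly the bumps at its letters into dips.\<close>

lemma trop_term_closed_factor:
  assumes "stirling_perm s (p @ B @ q)" "set B \<inter> (set p \<union> set q) = {}"
  shows "trop_term s h (route_level s p) (level_mult s p) (dips s (p @ B)) y =
    trop_term s h (route_level s p) (level_mult s p) (dips s p) y
    + (h (route s (p @ B)) - h (route s p)) + (\<Sum>i\<in>set B. Poly_Mapping.lookup y i)"
proof -
  let ?k = "route_level s p"
  note lev = closed_factor_level[OF assms]
  have "stirling_perm s ((p @ B) @ q)" using assms(1) by simp
  note R = route_eq_route_R[OF assms(1)] route_eq_route_R[OF this]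
  have "(\<Sum>i\<in>{1..<?k}. real (dips s (p @ B) i) * Poly_Mapping.lookup y i)
      = (\<Sum>i\<in>{1..<?k}. real (dips s p i) * Poly_Mapping.lookup y i
          + (if i \<in> set B then Poly_Mapping.lookup y i else 0))"
    using assms(2) by (intro sum.cong refl) (auto simp: dips_def lev)
  also have "\<dots> = (\<Sum>i\<in>{1..<?k}. real (dips s p i) * Poly_Mapping.lookup y i)
      + (\<Sum>i\<in>{1..<?k} \<inter> set B. Poly_Mapping.lookup y i)"
    by (simp add: sum.distrib sum.inter_restrict)
  also have "{1..<?k} \<inter> set B = set B" using lev(3) by blast
  finally show ?thesis
    unfolding trop_term_def R lev by simp
qed

text \<open>For the routes of a simplex this is the condition defining \<open>vert\<close>. Allowing
  arbitrary \<open>C\<close> lets it also describe cells with fewer minimizers, such as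
  edges.\<close>

definition supports :: "nat list \<Rightarrow> (edge list \<Rightarrow> real) \<Rightarrow> edge list set \<Rightarrow> (nat \<Rightarrow>\<^sub>0 real) \<Rightarrow> bool" where
  "supports s h C x \<longleftrightarrow> (\<forall>k\<in>{2..length s + 1}. \<forall>t\<in>{1..part s k - 1}. \<forall>\<delta>\<in>cube k.
     route_R s k t \<delta> \<in> C \<longrightarrow> \<delta> \<in> minimizers s h k t x)"

lemma supports_mono: "supports s h D x \<Longrightarrow> C \<subseteq> D \<Longrightarrow> supports s h C x"
  unfolding supports_def by blast

lemma supports_prefix:
  assumes "supports s h C y" "stirling_perm s (p @ q)" "route s p \<in> C" "2 \<le> route_level s p"
    "\<epsilon> \<in> cube (route_level s p)"
  shows "trop_term s h (route_level s p) (level_mult s p) (dips s p) y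
    \<le> trop_term s h (route_level s p) (level_mult s p) \<epsilon> y"
proof -
  have "route_level s p \<in> {2..length s + 1}" using assms(4) route_level_bounds[of s p] by simp
  then have "dips s p \<in> minimizers s h (route_level s p) (level_mult s p) y"
    using assms(1,3) level_mult_range[of s p] dips_in_cube[of s p]
    unfolding supports_def route_eq_route_R[OF assms(2)] by blast
  then show ?thesis using assms(5) by (simp add: minimizers_iff)
qed

text \<open>Minimality of either route against the other bounds the sum from one side. The
  directions are kept apart because the edge of a transposition is bounded by one inequality from
  each of two such pairs.\<close>

lemma closed_factor_sum_bounds:
  assumes "stirling_perm s (p @ B @ q)" "set B \<inter> (set p \<union> set q) = {}" "B \<noteq> []" "supports s h C y"
  shows "route s p \<in> C \<Longrightarrow>
      h (route s p) - h (route s (p @ B)) \<le> (\<Sum>i\<in>set B. Poly_Mapping.lookup y i)"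
    and "route s (p @ B) \<in> C \<Longrightarrow>
      (\<Sum>i\<in>set B. Poly_Mapping.lookup y i) \<le> h (route s p) - h (route s (p @ B))"
proof -
  note lev = closed_factor_level[OF assms(1,2)]
  have st: "stirling_perm s ((p @ B) @ q)" using assms(1) by simp
  \<comment> \<open>A letter below the level forces the level to be at least 2, the range in which
    \<open>supports\<close> says something.\<close>
  have "hd B \<in> {1..<route_level s p}" using lev(3) assms(3) by (meson hd_in_set subsetD)
  then have k: "2 \<le> route_level s p" by simp
  note T = trop_term_closed_factor[OF assms(1,2), of h y]
  have c: "dips s (p @ B) \<in> cube (route_level s p)" "dips s p \<in> cube (route_level s p)"
    using dips_in_cube[of s "p @ B"] dips_in_cube[of s p] lev(1) by auto
  show "h (route s p) - h (route s (p @ B)) \<le> (\<Sum>i\<in>set B. Poly_Mapping.lookup y i)"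
    if "route s p \<in> C"
    using supports_prefix[OF assms(4,1) that k c(1)] T by linarith
  show "(\<Sum>i\<in>set B. Poly_Mapping.lookup y i) \<le> h (route s p) - h (route s (p @ B))"
    if "route s (p @ B) \<in> C"
    using supports_prefix[OF assms(4) st that] k c(2) T unfolding lev by fastforce
qed

text \<open>Letters between two copies of \<open>b\<close> are at most \<open>b\<close>. A smaller
  letter of \<open>B\<close> recurring outside would enclose a copy of \<open>b\<close>, which is
  again excluded.\<close>

lemma block_closed:
  assumes "stirling_perm s (p @ B @ q)" "B \<noteq> []" "hd B = b" "last B = b" "b \<notin> set p" "b \<notin> set q"
  shows "set B \<subseteq> {1..b}" "set B \<inter> (set p \<union> set q) = {}"
proof -
  have *: "i \<le> b \<and> i \<notin> set p \<and> i \<notin> set q" if i: "i \<in> set B" "i \<noteq> b" for i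
  proof -
    obtain r where r: "B = b # r" using assms(2,3) by (cases B) auto
    then have "r \<noteq> []" using i by auto
    then have "r = butlast r @ [b]" using assms(4) r by (metis append_butlast_last_id last_ConsR)
    then obtain z where z': "r = z @ [b]" by blast
    then have z: "i \<in> set z" using i r by auto
    have B: "B = [b] @ z @ [b]" using r z' by simp
    have le: "i \<le> b"
      using stirling_between_le[of s "p @ [b]" z "b # q" b i] assms(1) z unfolding B by simp
    have "i \<notin> set p"
      using stirling_between_le[of s p "[b]" "z @ b # q" i b] assms(1) z le i(2) unfolding B by auto
    moreover have "i \<notin> set q"
      using stirling_between_le[of s "p @ b # z" "[b]" q i b] assms(1) z le i(2) unfolding B by auto
    ultimately show ?thesis using le by simp
  qed
  have "set B \<subseteq> {1..}" using assms(1) by (auto simp: stirling_perm_def)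
  then show "set B \<subseteq> {1..b}" using * by fastforce
  show "set B \<inter> (set p \<union> set q) = {}" using * assms(5,6) by blast
qed

text \<open>The factor from the first to the last occurrence of \<open>b\<close>; positivity of the
  part guarantees an occurrence.\<close>

lemma block_exists:
  assumes "composition s" "stirling_perm s w" "b \<in> {1..length s}"
  obtains p B q where "w = p @ B @ q" "B \<noteq> []" "hd B = b" "last B = b"
    "set B \<subseteq> {1..b}" "set B \<inter> (set p \<union> set q) = {}"
proof -
  have "count_list w b > 0" using part_pos[OF assms(1), of b] assms by (simp add: stirling_perm_def)
  then have "b \<in> set w" by (metis count_list_0_iff less_irrefl)
  then obtain p r where pr: "w = p @ b # r" "b \<notin> set p" by (meson split_list_first)
  then have "b \<in> set (b # r)" by simp
  then obtain z q where zq: "b # r = z @ b # q" "b \<notin> set q" by (metis split_list_last)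
  let ?B = "z @ [b]"
  have w: "w = p @ ?B @ q" using pr zq by simp
  have "hd ?B = b" using zq(1) by (cases z) auto
  then show thesis
    using that[OF w] block_closed[of s p ?B q b] assms(2) w pr(2) zq(2) by simp
qed

lemma prefix_with_count:
  "1 \<le> t \<Longrightarrow> t \<le> count_list w k \<Longrightarrow> \<exists>p q. w = p @ k # q \<and> Suc (count_list p k) = t"
proof (induction w arbitrary: t)
  case (Cons x w)
  show ?case
  proof (cases "x = k \<and> t = 1")
    case True
    then show ?thesis by (intro exI[of _ "[]"] exI[of _ w]) auto
  next
    case False
    let ?t = "if x = k then t - 1 else t"
    have "1 \<le> ?t" "?t \<le> count_list w k" using Cons.prems False by auto
    from Cons.IH[OF this] obtain p q where "w = p @ k # q" "Suc (count_list p k) = ?t" by blast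
    then show ?thesis using Cons.prems False by (intro exI[of _ "x # p"] exI[of _ q]) (auto split: if_splits)
  qed
qed simp

text \<open>The prefix ending at the \<open>t\<close>-th copy of \<open>k\<close> works: any other
  unfinished letter encloses that copy and is at least \<open>k\<close>. For k = n+1 the empty
  prefix is taken. The last clause later rules out a prefix ending in a completed block.\<close>

lemma prefix_with_source_edge:
  assumes "stirling_perm s w" "k \<in> {1..length s + 1}" "t \<in> {1..part s k - 1}"
  obtains p q where "w = p @ q" "route_level s p = k" "level_mult s p = t"
    "p = [] \<or> (last p = k \<and> count_list p k < part s k)"
proof (cases "k = length s + 1")
  case True
  have "route_level s [] = length s + 1"
    by (rule route_level_eqI) (auto simp: partial_letter_def)
  then show thesis using that[of "[]" w] True assms(3) by (simp add: level_mult_def)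
next
  case False
  then have k: "k \<in> {1..length s}" using assms(2) by auto
  have "t \<le> count_list w k" using assms(1,3) k by (auto simp: stirling_perm_def)
  then obtain p q where w: "w = p @ k # q" and c: "Suc (count_list p k) = t"
    using prefix_with_count[of t w k] assms(3) by auto
  have ct: "count_list (p @ [k]) k = t" using c by simp
  have st: "stirling_perm s ((p @ [k]) @ q)" using assms(1) w by simp
  have "route_level s (p @ [k]) = k"
  proof (rule route_level_eqI)
    show "k = length s + 1 \<or> partial_letter s (p @ [k]) k"
      using k ct assms(3) by (auto simp: partial_letter_def)
    show "k \<le> i" if "partial_letter s (p @ [k]) i" for i
      using that stirling_between_le[of s p "[k]" q i k] st
      unfolding partial_letter_split[OF st] by auto
  qed
  then show thesis
    using that[of "p @ [k]" q] w ct assms(3) k by (auto simp: level_mult_def)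
qed

text \<open>A homogeneous triangular system has only the zero solution: by strong induction all
  summands except \<open>d b\<close> vanish.\<close>

lemma triangular_sums_zero:
  fixes d :: "nat \<Rightarrow> real"
  assumes "\<And>b. b \<in> I \<Longrightarrow> \<exists>S. b \<in> S \<and> S \<subseteq> I \<inter> {..b} \<and> (\<Sum>i\<in>S. d i) = 0" "b \<in> I"
  shows "d b = 0"
  using assms(2)
proof (induction b rule: less_induct)
  case (less b)
  obtain S where S: "b \<in> S" "S \<subseteq> I \<inter> {..b}" "(\<Sum>i\<in>S. d i) = 0"
    using assms(1)[OF less.prems] by blast
  then have "finite S" using finite_subset by blast
  moreover have "d i = 0" if "i \<in> S - {b}" for i
  proof -
    have "i \<in> I \<inter> {..b}" using that S(2) by blast
    then show ?thesis using that less.IH[of i] by auto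
  qed
  ultimately have "(\<Sum>i\<in>S. d i) = d b"
    using S(1) by (simp add: sum.remove)
  then show ?case using S(3) by simp
qed

lemma poly_mapping_eqI_Rn:
  assumes "x \<in> Rn n" "y \<in> Rn n"
    "\<And>i. i \<in> {1..n} \<Longrightarrow> Poly_Mapping.lookup x i = Poly_Mapping.lookup y i"
  shows "x = y"
proof (rule poly_mapping_eqI)
  fix i
  show "Poly_Mapping.lookup x i = Poly_Mapping.lookup y i"
  proof (cases "i \<in> {1..n}")
    case False
    then have "i \<notin> Poly_Mapping.keys x" "i \<notin> Poly_Mapping.keys y"
      using assms(1,2) by (auto simp: Rn_def)
    then show ?thesis by (simp add: in_keys_iff)
  qed (rule assms(3))
qed

lemma closed_factor_sum_eq:
  assumes "stirling_perm s (p @ B @ q)" "set B \<inter> (set p \<union> set q) = {}" "B \<noteq> []"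
    "supports s h C y" "route s p \<in> C" "route s (p @ B) \<in> C"
  shows "(\<Sum>i\<in>set B. Poly_Mapping.lookup y i) = h (route s p) - h (route s (p @ B))"
  using closed_factor_sum_bounds[OF assms(1-4)] assms(5,6) by (intro antisym) simp_all

subsection \<open>Vertices\<close>

text \<open>Both points satisfy the same block equations, so their difference solves the homogeneous
  triangular system.\<close>

lemma supports_simplex_unique:
  assumes "composition s" "stirling_perm s w" "x \<in> Rn (length s)" "y \<in> Rn (length s)"
    "supports s h (simplex_routes s w) x" "supports s h (simplex_routes s w) y"
  shows "x = y"
proof (rule poly_mapping_eqI_Rn[OF assms(3,4)])
  let ?d = "\<lambda>i. Poly_Mapping.lookup x i - Poly_Mapping.lookup y i"
  fix i assume i: "i \<in> {1..length s}"
  have "?d i = 0"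
  proof (rule triangular_sums_zero[OF _ i])
    fix b assume "b \<in> {1..length s}"
    then obtain p B q where B: "w = p @ B @ q" "B \<noteq> []" "hd B = b"
        "set B \<subseteq> {1..b}" "set B \<inter> (set p \<union> set q) = {}"
      using block_exists[OF assms(1,2)] by metis
    have st: "stirling_perm s (p @ B @ q)" using assms(2) B(1) by simp
    have "w = (p @ B) @ q" using B(1) by simp
    then have "route s p \<in> simplex_routes s w" "route s (p @ B) \<in> simplex_routes s w"
      unfolding simplex_routes_iff using B(1) by blast+
    then have "(\<Sum>i\<in>set B. ?d i) = 0"
      using closed_factor_sum_eq[OF st B(5,2)] assms(5,6) by (simp add: sum_subtractf)
    moreover have "b \<in> set B" using B(2,3) hd_in_set by blast
    ultimately show "\<exists>S. b \<in> S \<and> S \<subseteq> {1..length s} \<inter> {..b} \<and> (\<Sum>i\<in>S. ?d i) = 0"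
      using B(4) \<open>b \<in> {1..length s}\<close> by (intro exI[of _ "set B"]) auto
  qed
  then show "Poly_Mapping.lookup x i = Poly_Mapping.lookup y i" by simp
qed

lemma simplex_covers_source_edges:
  assumes "stirling_perm s w" "k \<in> {2..length s + 1}" "t \<in> {1..part s k - 1}"
  shows "\<exists>\<delta>\<in>cube k. route_R s k t \<delta> \<in> simplex_routes s w"
proof -
  have "k \<in> {1..length s + 1}" using assms(2) by simp
  then obtain p q where p: "w = p @ q" "route_level s p = k" "level_mult s p = t"
    using prefix_with_source_edge[OF assms(1) _ assms(3)] by metis
  then have "route s p = route_R s k t (dips s p)"
    using route_eq_route_R[of s p q] assms(1) by simp
  then show ?thesis
    using p dips_in_cube[of s p] unfolding simplex_routes_iff by metis
qed

lemma simplex_routes_subset: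
  assumes "composition s" "stirling_perm s w"
  shows "simplex_routes s w \<subseteq> routes s"
  using route_in_routes[OF assms(1)] assms(2) by (auto simp: simplex_routes_iff)

lemma cell_eq_supports:
  assumes "\<And>k t. k \<in> {2..length s + 1} \<Longrightarrow> t \<in> {1..part s k - 1} \<Longrightarrow>
    minimizers s h k t x = {\<delta> \<in> cube k. route_R s k t \<delta> \<in> C}"
  shows "cell s h x = {y \<in> Rn (length s). supports s h C y}"
  unfolding cell_def supports_def using assms by blast

text \<open>\<open>admissible_point\<close> yields a point whose minimizers are exactly the routes
  of the simplex; uniqueness identifies it with \<open>vert\<close> and shrinks its cell to one
  point.\<close>

lemma vert_properties:
  assumes "composition s" "admissible s h" "stirling_perm s w"
  shows "vert s h w \<in> Rn (length s)" "supports s h (simplex_routes s w) (vert s h w)"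
    "\<And>k t. k \<in> {2..length s + 1} \<Longrightarrow> t \<in> {1..part s k - 1} \<Longrightarrow>
      minimizers s h k t (vert s h w) = {\<delta> \<in> cube k. route_R s k t \<delta> \<in> simplex_routes s w}"
    "{vert s h w} \<in> bounded_complex s h"
proof -
  let ?D = "simplex_routes s w"
  note sub = simplex_routes_subset[OF assms(1,3)]
  obtain x where x: "x \<in> Rn (length s)"
    and "\<forall>k\<in>{2..length s + 1}. \<forall>t\<in>{1..part s k - 1}.
      minimizers s h k t x = {\<delta> \<in> cube k. route_R s k t \<delta> \<in> ?D}"
    using admissible_point[OF assms(1,2) sub coherent_simplex_routes[OF assms(3)]
        simplex_covers_source_edges[OF assms(3)]] by blast
  note min = this(2)[rule_format]
  have sup: "supports s h ?D x"
    unfolding supports_def using min by blast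
  have "vert s h w = (THE x. x \<in> Rn (length s) \<and> supports s h ?D x)"
    by (simp add: vert_def supports_def)
  also have "\<dots> = x"
    using x sup supports_simplex_unique[OF assms(1,3)] by (intro the_equality) auto
  finally have v: "vert s h w = x" .
  show "vert s h w \<in> Rn (length s)" "supports s h ?D (vert s h w)"
    unfolding v by (fact x sup)+
  show "minimizers s h k t (vert s h w) = {\<delta> \<in> cube k. route_R s k t \<delta> \<in> ?D}"
    if "k \<in> {2..length s + 1}" "t \<in> {1..part s k - 1}" for k t
    unfolding v using that by (rule min)
  have "cell s h x = {x}"
    using cell_eq_supports[OF min] x sup supports_simplex_unique[OF assms(1,3)] by blast
  then show "{vert s h w} \<in> bounded_complex s h"
    unfolding bounded_complex_def v using x by force
qed

section \<open>Convexity of the support condition\<close>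

lemma trop_term_convex_combination:
  "trop_term s h k t \<delta> ((1 - u) *\<^sub>R x + u *\<^sub>R y) =
    (1 - u) * trop_term s h k t \<delta> x + u * trop_term s h k t \<delta> y"
proof -
  have "(\<Sum>i\<in>{1..<k}. real (\<delta> i) * Poly_Mapping.lookup ((1 - u) *\<^sub>R x + u *\<^sub>R y) i)
      = (\<Sum>i\<in>{1..<k}. (1 - u) * (real (\<delta> i) * Poly_Mapping.lookup x i)
          + u * (real (\<delta> i) * Poly_Mapping.lookup y i))"
    by (intro sum.cong refl) (simp add: lookup_add distrib_left)
  then show ?thesis
    by (simp add: trop_term_def sum.distrib flip: sum_distrib_left) (simp add: algebra_simps)
qed

lemma supports_closed_segment:
  assumes "supports s h C x" "supports s h C y" "z \<in> closed_segment x y"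
  shows "supports s h C z"
  unfolding supports_def
proof (intro ballI impI)
  fix k t \<delta>
  assume *: "k \<in> {2..length s + 1}" "t \<in> {1..part s k - 1}" "\<delta> \<in> cube k" "route_R s k t \<delta> \<in> C"
  obtain u where u: "z = (1 - u) *\<^sub>R x + u *\<^sub>R y" "0 \<le> u" "u \<le> 1"
    using assms(3) by (auto simp: closed_segment_def)
  have "\<delta> \<in> minimizers s h k t x" "\<delta> \<in> minimizers s h k t y"
    using assms(1,2) * by (auto simp: supports_def)
  then show "\<delta> \<in> minimizers s h k t z"
    using u(2,3) *(3) unfolding minimizers_iff u(1) trop_term_convex_combination
    by (auto intro!: add_mono mult_left_mono)
qed

lemma Rn_closed_segment:
  assumes "x \<in> Rn n" "y \<in> Rn n" "z \<in> closed_segment x y"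
  shows "z \<in> Rn n"
proof -
  obtain u where u: "z = (1 - u) *\<^sub>R x + u *\<^sub>R y"
    using assms(3) by (auto simp: closed_segment_def)
  have "i \<in> {1..n}" if "Poly_Mapping.lookup z i \<noteq> 0" for i
  proof -
    have "Poly_Mapping.lookup x i \<noteq> 0 \<or> Poly_Mapping.lookup y i \<noteq> 0"
      using that unfolding u by (auto simp: lookup_add)
    then show ?thesis using assms(1,2) by (auto simp: Rn_def in_keys_iff)
  qed
  then show ?thesis by (auto simp: Rn_def in_keys_iff)
qed

section \<open>Words with equal routes\<close>

lemma route_cong_count:
  assumes "\<And>i. count_list u i = count_list v i"
  shows "route s u = route s v"
  using assms by (simp add: route_def route_level_def)

text \<open>An unfinished letter \<open>a\<close> bounds the level by \<open>a\<close>, so the route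
  records no letter above \<open>a\<close>.\<close>

lemma route_cong_below:
  assumes "partial_letter s u a" "\<And>i. i \<le> a \<Longrightarrow> count_list u i = count_list v i"
  shows "route s u = route s v"
proof -
  have le: "route_level s u \<le> a"
    using assms(1) not_partial_below_level not_less by blast
  have eq: "partial_letter s u i \<longleftrightarrow> partial_letter s v i" if "i \<le> a" for i
    using assms(2)[OF that] by (simp add: partial_letter_def)
  have "route_level s v = route_level s u"
  proof (rule route_level_eqI)
    show "route_level s u = length s + 1 \<or> partial_letter s v (route_level s u)"
      using route_level_cases[of s u] eq[OF le] by simp
    show "route_level s u \<le> i" if "partial_letter s v i" for i
      using that eq[of i] le not_partial_below_level[of i s u] by (meson le_trans linear not_less)
  qed
  then show ?thesis
    unfolding route_def using le assms(2) by (auto simp del: upt_Suc)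
qed

subsection \<open>Transposing a block with a larger letter\<close>

text \<open>The block enters through its end letters and the absence of \<open>a\<close> elsewhere,
  the form that \<open>block_closed\<close> takes.\<close>

locale block_transposition =
  fixes s :: "nat list" and a c :: nat and u1 B u2 :: "nat list"
  assumes comp: "composition s"
    and less: "a < c"
    and stirling: "stirling_perm s (u1 @ B @ c # u2)"
    and stirling': "stirling_perm s (u1 @ c # B @ u2)"
    and block: "B \<noteq> []" "hd B = a" "last B = a" "a \<notin> set u1" "a \<notin> set u2"
begin

abbreviation "w \<equiv> u1 @ B @ c # u2"
abbreviation "w' \<equiv> u1 @ c # B @ u2"
abbreviation "common \<equiv> simplex_routes s w \<inter> simplex_routes s w'"

lemma block_le: "set B \<subseteq> {1..a}"
  and block_disjoint: "set B \<inter> (set u1 \<union> set (c # u2)) = {}"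
  using block_closed[OF stirling block(1-3)] block(4,5) less by auto

lemma letters: "a \<in> set B" "c \<notin> set B" "a \<in> {1..length s}" "c \<in> {1..length s}"
proof -
  show "a \<in> set B" using block(1,2) hd_in_set by blast
  then show "c \<notin> set B" "a \<in> {1..length s}" "c \<in> {1..length s}"
    using block_disjoint stirling by (auto simp: stirling_perm_def)
qed

text \<open>A prefix other than \<open>u1 @ B\<close> ends within \<open>u1\<close>, strictly inside
  \<open>B\<close>, or after the displayed \<open>c\<close>; these cases are governed by different
  arguments.\<close>

lemma prefix_cases:
  assumes "w = p @ q" "p \<noteq> u1 @ B"
  obtains z where "u1 = p @ z" "q = z @ B @ c # u2"
  | z z' where "B = z @ z'" "z \<noteq> []" "z' \<noteq> []" "p = u1 @ z" "q = z' @ c # u2"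
  | z where "p = u1 @ B @ c # z" "u2 = z @ q"
proof -
  consider z where "u1 = p @ z" "q = z @ B @ c # u2" | z where "p = u1 @ z" "z @ q = B @ c # u2"
    using assms(1) unfolding append_eq_append_conv2[of u1] by metis
  then show thesis
  proof cases
    case 1
    then show thesis using that(1) by blast
  next
    case (2 z)
    consider z' where "B = z @ z'" "q = z' @ c # u2" | z' where "z = B @ z'" "z' @ q = c # u2"
      using 2(2) unfolding append_eq_append_conv2[of z] by metis
    then show thesis
    proof cases
      case (1 z')
      show thesis
      proof (cases "z = []")
        case True
        then show thesis using that(1)[of "[]"] 1 2 by simp
      next
        case False
        moreover have "z' \<noteq> []" using 1 2 assms(2) by auto
        ultimately show thesis using that(2) 1 2 by blast
      qed
    next
      case (2 z')
      then have "z' \<noteq> []" using assms(2) \<open>p = u1 @ z\<close> by auto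
      then show thesis using that(3)[of "tl z'"] 2 \<open>p = u1 @ z\<close> by (cases z') auto
    qed
  qed
qed

lemma route_swapped: "route s (u1 @ c # B @ z) = route s (u1 @ B @ c # z)"
  by (rule route_cong_count) simp

text \<open>Within \<open>u1\<close> the words agree. Strictly inside \<open>B\<close> the letter
  \<open>a\<close> is unfinished, so the larger letter \<open>c\<close> does not affect the route.
  After \<open>c\<close> the letter counts agree.\<close>

lemma route_in_common:
  assumes "w = p @ q" "p \<noteq> u1 @ B"
  shows "route s p \<in> common"
proof -
  have "route s p \<in> simplex_routes s w'"
    using assms
  proof (cases rule: prefix_cases)
    case (1 z)
    then have "w' = p @ z @ c # B @ u2" by simp
    then show ?thesis unfolding simplex_routes_iff by blast
  next
    case (2 z z')
    have "a \<in> set z" using 2 block(2) by (cases z) auto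
    moreover have "a \<in> set z'" using 2 block(3) by (metis last_appendR last_in_set)
    ultimately have "partial_letter s p a"
      using 2 stirling partial_letter_split[of s "u1 @ z" "z' @ c # u2"] by simp
    then have "route s p = route s (u1 @ c # z)"
      using 2 less by (intro route_cong_below) auto
    moreover have "w' = (u1 @ c # z) @ z' @ u2" using 2 by simp
    ultimately show ?thesis unfolding simplex_routes_iff by blast
  next
    case (3 z)
    then have "w' = (u1 @ c # B @ z) @ q" by simp
    moreover have "route s p = route s (u1 @ c # B @ z)" using 3 route_swapped by simp
    ultimately show ?thesis unfolding simplex_routes_iff by blast
  qed
  then show ?thesis using assms(1) unfolding Int_iff simplex_routes_iff[of _ _ w] by blast
qed

text \<open>The prefix supplied for a source edge is empty or ends in an unfinished letter, whereas
  \<open>u1 @ B\<close> ends in the completed letter \<open>a\<close>. Its route is therefore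
  common.\<close>

lemma common_covers_source_edges:
  assumes "k \<in> {2..length s + 1}" "t \<in> {1..part s k - 1}"
  shows "\<exists>\<delta>\<in>cube k. route_R s k t \<delta> \<in> common"
proof -
  obtain p q where p: "w = p @ q" "route_level s p = k" "level_mult s p = t"
      "p = [] \<or> (last p = k \<and> count_list p k < part s k)"
    using prefix_with_source_edge[OF stirling _ assms(2)] assms(1)
    by (metis atLeastAtMost_iff le_trans one_le_numeral)
  have "count_list (u1 @ B) a = part s a"
    using count_list_split[of s "u1 @ B" "c # u2" a] stirling letters(3) less block(5) by simp
  then have "p \<noteq> u1 @ B" using p(4) block by auto
  then have "route s p \<in> common" using route_in_common p(1) by blast
  moreover have "route s p = route_R s k t (dips s p)"
    using route_eq_route_R[of s p q] stirling p by simp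
  ultimately show ?thesis using p dips_in_cube[of s p] by metis
qed

text \<open>The level of \<open>u1 @ B\<close> is at least \<open>c\<close>, so its route records
  the counts of both \<open>a\<close> and \<open>c\<close>. A prefix of \<open>w'\<close> containing
  \<open>a\<close> extends beyond \<open>u1 @ [c]\<close> and has a \<open>c\<close> too
  many.\<close>

lemma route_before_not_in_other: "route s (u1 @ B) \<notin> simplex_routes s w'"
proof
  assume "route s (u1 @ B) \<in> simplex_routes s w'"
  then obtain p q where p: "w' = p @ q" "route s (u1 @ B) = route s p"
    unfolding simplex_routes_iff by blast
  let ?k = "route_level s (u1 @ B)"
  have "length (route s u) = route_level s u" for u by (simp add: route_def)
  then have k: "route_level s p = ?k" using p(2) by metis
  have st: "stirling_perm s ((u1 @ B) @ c # u2)" using stirling by simp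
  have "c - 1 < ?k"
  proof (rule less_route_levelI)
    show "c - 1 < i" if i: "partial_letter s (u1 @ B) i" for i
    proof -
      have "i = c \<or> i \<in> set u2" "i \<in> set (u1 @ B)" using i partial_letter_split[OF st] by auto
      then have "c \<le> i" using stirling_between_le[of s "u1 @ B" "[c]" u2 i c] stirling by auto
      then show ?thesis using letters(4) by auto
    qed
  qed (use letters in auto)
  then have "c \<le> ?k" by simp
  have cnt: "count_list (u1 @ B) i = count_list p i" if "i \<in> {1..c}" for i
  proof -
    have i: "i \<in> set (rev [1..<?k + 1])" using that \<open>c \<le> ?k\<close> by (auto simp del: upt_Suc)
    have "i \<noteq> length s + 1" using that letters(4) by auto
    have "\<forall>x\<in>set (rev [1..<?k + 1]).
        (x, if x = length s + 1 then 1 else count_list (u1 @ B) x)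
        = (x, if x = length s + 1 then 1 else count_list p x)"
      using p(2) unfolding route_def k map_eq_conv .
    from bspec[OF this i] show ?thesis using \<open>i \<noteq> length s + 1\<close> by simp
  qed
  have "count_list B a \<noteq> 0" using letters(1) by (simp add: count_list_0_iff)
  then have "count_list p a \<noteq> 0" using cnt[of a] letters(3) less by simp
  then have "a \<in> set p" by (simp add: count_list_0_iff)
  have "(u1 @ [c]) @ B @ u2 = p @ q" using p(1) by simp
  then obtain z where "u1 @ [c] = p @ z \<or> p = (u1 @ [c]) @ z"
    unfolding append_eq_append_conv2[of "u1 @ [c]"] by blast
  moreover have "u1 @ [c] \<noteq> p @ z"
  proof
    assume "u1 @ [c] = p @ z"
    then have "a \<in> set (u1 @ [c])" using \<open>a \<in> set p\<close> by simp
    then show False using block(4) less by simp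
  qed
  ultimately have "p = u1 @ c # z" by simp
  then show False
    using cnt[of c] letters(2,4) by (simp add: count_list_0_iff)
qed

text \<open>For \<open>b < a\<close> the block of \<open>b\<close> is too small to contain either
  letter. Otherwise \<open>b\<close> is not in \<open>B\<close>, so the block cannot begin or end
  within \<open>B @ [c]\<close> and contains this factor entirely or avoids both letters.\<close>

lemma contains_both_or_none:
  assumes D: "w = p @ D @ q" "D \<noteq> []" "hd D = b" "last D = b" "set D \<subseteq> {1..b}"
    "set D \<inter> (set p \<union> set q) = {}" and b: "b \<noteq> a" "b \<noteq> c"
  shows "a \<in> set D \<longleftrightarrow> c \<in> set D"
proof (cases "b < a")
  case True
  then show ?thesis using D(5) less by auto
next
  case False
  then have bB: "b \<notin> set B" using b block_le by auto
  have "p \<noteq> u1 @ B" using D(1-3) b(2) by (cases D) auto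
  have "p @ D \<noteq> u1 @ B" using D(2,4) b(1) block by (metis last_appendR)
  have p: "(\<exists>z. u1 = p @ z) \<or> (\<exists>z. p = u1 @ B @ c # z)"
    using D(1) \<open>p \<noteq> u1 @ B\<close>
  proof (cases rule: prefix_cases)
    case (2 z z')
    then have "hd D = hd z'" using D(2) by (metis hd_append2)
    then show ?thesis using 2 bB D(3) by auto
  qed auto
  have "w = (p @ D) @ q" using D(1) by simp
  then have r: "(\<exists>z. q = z @ B @ c # u2) \<or> (\<exists>z. p @ D = u1 @ B @ c # z \<and> u2 = z @ q)"
    using \<open>p @ D \<noteq> u1 @ B\<close>
  proof (cases rule: prefix_cases)
    case (2 z z')
    then have "last D = last z" using D(2) by (metis last_appendR)
    then show ?thesis using 2 bB D(4) by auto
  qed auto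
  show ?thesis
  proof (cases "a \<in> set D \<or> c \<in> set D")
    case True
    then have "\<not> (\<exists>z. p = u1 @ B @ c # z)" "\<not> (\<exists>z. q = z @ B @ c # u2)"
      using D(6) letters(1) by auto
    then obtain z z' where "u1 = p @ z" "p @ D = u1 @ B @ c # z'" using p r by blast
    then have "D = z @ B @ c # z'" by simp
    then show ?thesis using letters(1) by simp
  qed simp
qed

lemma common_sum_eq:
  assumes "w = p @ D @ q" "set D \<inter> (set p \<union> set q) = {}" "D \<noteq> []"
    "p \<noteq> u1 @ B" "p @ D \<noteq> u1 @ B" "supports s h common y" "supports s h common y'"
  shows "(\<Sum>i\<in>set D. Poly_Mapping.lookup y' i - Poly_Mapping.lookup y i) = 0"
proof -
  have st: "stirling_perm s (p @ D @ q)" using stirling assms(1) by simp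
  have "route s p \<in> common" "route s (p @ D) \<in> common"
    using route_in_common[of p "D @ q"] route_in_common[of "p @ D" q] assms(1,4,5) by auto
  then show ?thesis
    using closed_factor_sum_eq[OF st assms(2,3)] assms(6,7) by (simp add: sum_subtractf)
qed

text \<open>The blocks of letters other than \<open>a\<close> and \<open>c\<close> keep their
  equations. Together with one equation involving both \<open>a\<close> and \<open>c\<close>, they
  confine the solutions to a line.\<close>

lemma difference_of_common_supports:
  assumes "y \<in> Rn (length s)" "y' \<in> Rn (length s)" "supports s h common y" "supports s h common y'"
  defines "d \<equiv> \<lambda>i. Poly_Mapping.lookup y' i - Poly_Mapping.lookup y i"
  shows "y' = y + d a *\<^sub>R (Poly_Mapping.single a 1 - Poly_Mapping.single c 1)"
proof -
  have other: "\<exists>D. b \<in> set D \<and> set D \<subseteq> {1..b} \<and> (\<Sum>i\<in>set D. d i) = 0 \<and> (a \<in> set D \<longleftrightarrow> c \<in> set D)"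
    if b: "b \<in> {1..length s}" "b \<noteq> a" "b \<noteq> c" for b
  proof -
    obtain p D q where D: "w = p @ D @ q" "D \<noteq> []" "hd D = b" "last D = b"
        "set D \<subseteq> {1..b}" "set D \<inter> (set p \<union> set q) = {}"
      by (rule block_exists[OF comp stirling b(1)])
    have "p \<noteq> u1 @ B" using D(1-3) b(3) by (cases D) auto
    moreover have "p @ D \<noteq> u1 @ B" using D(2,4) b(2) block by (metis last_appendR)
    ultimately have "(\<Sum>i\<in>set D. d i) = 0"
      unfolding d_def using common_sum_eq[OF D(1,6,2) _ _ assms(3,4)] by blast
    moreover have "b \<in> set D" using D(2,3) hd_in_set by blast
    ultimately show ?thesis using contains_both_or_none[OF D b(2,3)] D(5) by blast
  qed
  \<comment> \<open>For \<open>b < c\<close> the block of \<open>b\<close> omits \<open>c\<close>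
    and therefore also \<open>a\<close>, so the equations for these indices form a triangular system
    of their own.\<close>
  have small: "d b = 0" if "b \<in> {1..<c} - {a}" for b
  proof (rule triangular_sums_zero[OF _ that])
    fix b assume b: "b \<in> {1..<c} - {a}"
    then obtain D where D: "b \<in> set D" "set D \<subseteq> {1..b}" "(\<Sum>i\<in>set D. d i) = 0"
        "a \<in> set D \<longleftrightarrow> c \<in> set D"
      using other[of b] letters(4) by auto
    then have "set D \<subseteq> ({1..<c} - {a}) \<inter> {..b}" using b by auto
    then show "\<exists>S. b \<in> S \<and> S \<subseteq> ({1..<c} - {a}) \<inter> {..b} \<and> sum d S = 0" using D by blast
  qed
  \<comment> \<open>If \<open>c\<close> occurs in \<open>u1\<close>, the \<open>c\<close>-block
    encloses \<open>B\<close> and is taken as \<open>D\<close>. Otherwise it starts right after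
    \<open>B\<close>, and \<open>B\<close> joined with it is a closed factor whose ends avoid
    \<open>u1 @ B\<close>.\<close>
  have "\<exists>D. a \<in> set D \<and> c \<in> set D \<and> set D \<subseteq> {1..c} \<and> (\<Sum>i\<in>set D. d i) = 0"
  proof -
    obtain p D q where D: "w = p @ D @ q" "D \<noteq> []" "hd D = c" "last D = c"
        "set D \<subseteq> {1..c}" "set D \<inter> (set p \<union> set q) = {}"
      by (rule block_exists[OF comp stirling letters(4)])
    have cD: "c \<in> set D" using D(2,3) hd_in_set by blast
    show ?thesis
    proof (cases "c \<in> set u1")
      case True
      then have pn: "p \<noteq> u1 @ B" using D(6) cD by auto
      have rn: "p @ D \<noteq> u1 @ B" using D(2,4) less block by (metis last_appendR less_irrefl)
      have "a \<notin> set p"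
        using D(1) pn
      proof (cases rule: prefix_cases)
        case 1
        then show ?thesis using block(4) by auto
      qed (use True cD D(6) in auto)
      moreover have "a \<notin> set q"
      proof -
        have "w = (p @ D) @ q" using D(1) by simp
        then show ?thesis using rn
        proof (cases rule: prefix_cases)
          case 3
          then show ?thesis using block(5) by auto
        qed (use cD D(6) in auto)
      qed
      moreover have "a \<in> set (p @ D @ q)" using letters(1) D(1) by (metis UnCI set_append)
      ultimately have "a \<in> set D" by auto
      then show ?thesis
        using cD D(5) common_sum_eq[OF D(1,6,2) pn rn assms(3,4)] unfolding d_def by blast
    next
      case False
      have cp: "c \<notin> set p" using D(6) cD by auto
      have p: "p = u1 @ B"
      proof (rule ccontr)
        assume pn: "p \<noteq> u1 @ B"
        show False
          using D(1) pn
        proof (cases rule: prefix_cases)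
          case (1 z)
          then have "D @ q = (z @ B) @ c # u2" by simp
          moreover have "hd (z @ B) \<noteq> c"
            using False 1 letters(2) block(1) by (metis Un_iff append_is_Nil_conv hd_in_set set_append)
          ultimately show False using D(2,3) block(1)
            by (metis append_is_Nil_conv hd_append2)
        next
          case (2 z z')
          then have "hd D = hd z'" using D(2) by (metis hd_append2)
          then show False using 2 D(3) letters(2) by auto
        next
          case 3
          then show False using cp by auto
        qed
      qed
      have disj: "set (B @ D) \<inter> (set u1 \<union> set q) = {}"
      proof -
        have "u2 = tl D @ q" using D(1-3) p by (cases D) auto
        then show ?thesis using D(6) p block_disjoint by auto
      qed
      have "(\<Sum>i\<in>set (B @ D). d i) = 0"
        unfolding d_def using common_sum_eq[of u1 "B @ D" q, OF _ disj _ _ _ assms(3,4)] D(1,2) p block(1)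
        by simp
      moreover have "set (B @ D) \<subseteq> {1..c}" using D(5) block_le less by fastforce
      ultimately show ?thesis using letters(1) cD by (intro exI[of _ "B @ D"]) auto
    qed
  qed
  then obtain D where D: "a \<in> set D" "c \<in> set D" "set D \<subseteq> {1..c}" "(\<Sum>i\<in>set D. d i) = 0"
    by blast
  have "d i = 0" if "i \<in> set D - {a, c}" for i
  proof -
    have "i \<in> {1..c}" using that D(3) by blast
    then show ?thesis using that by (intro small) auto
  qed
  then have "(\<Sum>i\<in>set D. d i) = (\<Sum>i\<in>{a, c}. d i)"
    using D(1,2) by (intro sum.mono_neutral_right) auto
  then have dc: "d c = - d a" using D(4) less by simp
  \<comment> \<open>Subtracting the expected multiple of the direction gives a function vanishing at
    \<open>a\<close> and \<open>c\<close>. Blocks of other letters contain both or neither, so their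
    sums remain zero.\<close>
  define e where "e i = d i - (if i = a then d a else 0) - (if i = c then - d a else 0)" for i
  have e0: "e b = 0" if "b \<in> {1..length s}" for b
  proof (rule triangular_sums_zero[OF _ that])
    fix b assume b: "b \<in> {1..length s}"
    show "\<exists>S. b \<in> S \<and> S \<subseteq> {1..length s} \<inter> {..b} \<and> sum e S = 0"
    proof (cases "b = a \<or> b = c")
      case True
      then have "e b = 0" using dc less by (auto simp: e_def)
      then show ?thesis using b by (intro exI[of _ "{b}"]) auto
    next
      case False
      then obtain D where D: "b \<in> set D" "set D \<subseteq> {1..b}" "(\<Sum>i\<in>set D. d i) = 0"
          "a \<in> set D \<longleftrightarrow> c \<in> set D"
        using other b by blast
      have "(\<Sum>i\<in>set D. e i) = 0"
        unfolding e_def using D(3,4) by (simp add: sum_subtractf)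
      then show ?thesis using D b by (intro exI[of _ "set D"]) auto
    qed
  qed
  show ?thesis
  proof (rule poly_mapping_eqI)
    fix i
    show "Poly_Mapping.lookup y' i = Poly_Mapping.lookup
        (y + d a *\<^sub>R (Poly_Mapping.single a 1 - Poly_Mapping.single c 1)) i"
    proof (cases "i \<in> {1..length s}")
      case True
      then have "d i = (if i = a then d a else 0) + (if i = c then - d a else 0)"
        using e0[of i] by (simp add: e_def)
      moreover have "Poly_Mapping.lookup y' i = Poly_Mapping.lookup y i + d i"
        by (simp add: d_def)
      ultimately show ?thesis
        using less by (simp add: lookup_add lookup_minus lookup_single when_def)
    next
      case False
      then have "Poly_Mapping.lookup y i = 0" "Poly_Mapping.lookup y' i = 0" "i \<noteq> a" "i \<noteq> c"
        using assms(1,2) letters by (auto simp: Rn_def in_keys_iff)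
      then show ?thesis by (simp add: lookup_add lookup_minus lookup_single when_def)
    qed
  qed
qed

text \<open>As \<open>B\<close> contains \<open>a\<close> but not \<open>c\<close>, the sum over the
  block is a coordinate along the direction of the edge.\<close>

lemma sum_block_shift:
  "(\<Sum>i\<in>set B. Poly_Mapping.lookup (y + r *\<^sub>R (Poly_Mapping.single a 1 - Poly_Mapping.single c 1)) i)
    = (\<Sum>i\<in>set B. Poly_Mapping.lookup y i) + r"
proof -
  have "(\<Sum>i\<in>set B. Poly_Mapping.lookup (y + r *\<^sub>R (Poly_Mapping.single a 1 - Poly_Mapping.single c 1)) i)
      = (\<Sum>i\<in>set B. Poly_Mapping.lookup y i + (if i = a then r else 0))"
    using letters(2) by (intro sum.cong refl) (auto simp: lookup_add lookup_minus lookup_single when_def)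
  then show ?thesis using letters(1) by (simp add: sum.distrib)
qed

lemma routes_around_block:
  "route s u1 \<in> common" "route s (u1 @ B @ [c]) \<in> common"
  "route s (u1 @ B) \<in> simplex_routes s w" "route s (u1 @ [c]) \<in> simplex_routes s w'"
proof -
  show "route s u1 \<in> common" "route s (u1 @ B @ [c]) \<in> common"
    using route_in_common[of u1] route_in_common[of "u1 @ B @ [c]" u2] block(1) by auto
  have "w = (u1 @ B) @ c # u2" "w' = (u1 @ [c]) @ B @ u2" by simp_all
  then show "route s (u1 @ B) \<in> simplex_routes s w" "route s (u1 @ [c]) \<in> simplex_routes s w'"
    unfolding simplex_routes_iff by blast+
qed

text \<open>The block sum parametrises the line containing the edge; its values at the two vertices
  are known from the closed factor \<open>B\<close> in each word and differ by
  \<open>r\<close>.\<close>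

lemma edge_and_difference:
  assumes adm: "admissible s h"
  defines "r \<equiv> h (route s (u1 @ [c])) + h (route s (u1 @ B)) - h (route s u1) - h (route s (u1 @ B @ [c]))"
  shows "vert s h w' - vert s h w = r *\<^sub>R (Poly_Mapping.single a 1 - Poly_Mapping.single c 1)"
    and "edge_between (bounded_complex s h) (vert s h w) (vert s h w')"
proof -
  let ?v = "vert s h w" and ?v' = "vert s h w'"
  let ?e = "Poly_Mapping.single a 1 - Poly_Mapping.single c 1 :: nat \<Rightarrow>\<^sub>0 real"
  let ?sum = "\<lambda>y. \<Sum>i\<in>set B. Poly_Mapping.lookup y i"
  note v = vert_properties[OF comp adm stirling] and v' = vert_properties[OF comp adm stirling']
  have sv: "supports s h common ?v" "supports s h common ?v'"
    using v(2) v'(2) by (auto elim: supports_mono)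
  have st': "stirling_perm s ((u1 @ [c]) @ B @ u2)" using stirling' by simp
  have disj': "set B \<inter> (set (u1 @ [c]) \<union> set u2) = {}" using block_disjoint by auto
  have swap: "route s ((u1 @ [c]) @ B) = route s (u1 @ B @ [c])"
    using route_swapped[of "[]"] by simp
  have sumv: "?sum ?v = h (route s u1) - h (route s (u1 @ B))"
    using closed_factor_sum_eq[OF stirling block_disjoint block(1) v(2)] routes_around_block by auto
  have sumv': "?sum ?v' = h (route s (u1 @ [c])) - h (route s (u1 @ B @ [c]))"
    using closed_factor_sum_eq[OF st' disj' block(1) v'(2)] routes_around_block swap by auto
  have line: "y = ?v + (?sum y - ?sum ?v) *\<^sub>R ?e" 
    if y: "y \<in> Rn (length s)" "supports s h common y" for y
  proof -
    obtain m where "y = ?v + m *\<^sub>R ?e"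
      using difference_of_common_supports[OF v(1) y(1) sv(1) y(2)] by blast
    then show ?thesis using sum_block_shift[of ?v m] by simp
  qed
  have r: "?sum ?v' - ?sum ?v = r" using sumv sumv' by (simp add: r_def)
  have eq: "?v' = ?v + r *\<^sub>R ?e" using line[OF v'(1) sv(2)] unfolding r .
  then show "?v' - ?v = r *\<^sub>R ?e" by simp
  \<comment> \<open>Minimizers at a vertex are exactly the routes of its simplex, so equal vertices
    would put the route of \<open>u1 @ B\<close> into both simplices.\<close>
  have ne: "?v \<noteq> ?v'"
  proof
    assume "?v = ?v'"
    have st: "stirling_perm s ((u1 @ B) @ c # u2)" using stirling by simp
    let ?k = "route_level s (u1 @ B)" and ?t = "level_mult s (u1 @ B)"
    have "a < ?k"
      using closed_factor_level[OF stirling block_disjoint] letters(1) by auto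
    then have k: "?k \<in> {2..length s + 1}" "?t \<in> {1..part s ?k - 1}"
      using letters(3) route_level_bounds(2)[of s "u1 @ B"] level_mult_range[of s "u1 @ B"] by auto
    have "dips s (u1 @ B) \<in> minimizers s h ?k ?t ?v"
      using v(3)[OF k] routes_around_block(3) dips_in_cube route_eq_route_R[OF st] by simp
    then have "route s (u1 @ B) \<in> simplex_routes s w'"
      using v'(3)[OF k] \<open>?v = ?v'\<close> route_eq_route_R[OF st] by simp
    then show False using route_before_not_in_other by blast
  qed
  have sub: "common \<subseteq> routes s"
    using simplex_routes_subset[OF comp stirling] by blast
  have coh: "coherent s P Q" if "P \<in> common" "Q \<in> common" for P Q
    using that coherent_simplex_routes[OF stirling] by blast
  \<comment> \<open>This point has exactly the common routes as minimizers, so its cell consists of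
    all points supporting \<open>common\<close>; that cell is shown to be the segment.\<close>
  obtain x where x: "x \<in> Rn (length s)"
    and "\<forall>k\<in>{2..length s + 1}. \<forall>t\<in>{1..part s k - 1}.
      minimizers s h k t x = {\<delta> \<in> cube k. route_R s k t \<delta> \<in> common}"
    using admissible_point[OF comp adm sub coh common_covers_source_edges] by blast
  note min = this(2)[rule_format]
  \<comment> \<open>The route of \<open>u1\<close> gives the lower bound and the route of
    \<open>u1 @ B @ [c]\<close> the upper one. The exchanged routes enter only through the bounds,
    which the vertices attain.\<close>
  have bounds: "?sum ?v \<le> ?sum y" "?sum y \<le> ?sum ?v'" if "supports s h common y" for y
    using closed_factor_sum_bounds(1)[OF stirling block_disjoint block(1) that]
      closed_factor_sum_bounds(2)[OF st' disj' block(1) that] routes_around_block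
    unfolding sumv sumv' swap by auto
  have "0 \<le> r" using bounds(1)[OF sv(2)] r by simp
  moreover have "r \<noteq> 0" using ne eq by auto
  ultimately have rpos: "0 < r" by simp
  have "cell s h x = closed_segment ?v ?v'"
  proof (intro equalityI subsetI)
    fix y assume "y \<in> cell s h x"
    then have y: "y \<in> Rn (length s)" "supports s h common y"
      using cell_eq_supports[OF min] by auto
    \<comment> \<open>The normalised block sum is the parameter of \<open>y\<close> on the
      segment.\<close>
    define \<mu> where "\<mu> = (?sum y - ?sum ?v) / r"
    have "0 \<le> \<mu>" "\<mu> \<le> 1"
      using bounds[OF y(2)] rpos r by (auto simp: \<mu>_def)
    moreover have "y = (1 - \<mu>) *\<^sub>R ?v + \<mu> *\<^sub>R ?v'"
    proof -
      have "y = ?v + (\<mu> * r) *\<^sub>R ?e" using line[OF y] rpos by (simp add: \<mu>_def)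
      also have "\<dots> = (1 - \<mu>) *\<^sub>R ?v + \<mu> *\<^sub>R (?v + r *\<^sub>R ?e)"
        by (simp add: scaleR_add_right scaleR_diff_left del: scaleR_right_diff_distrib)
      finally show ?thesis using eq by simp
    qed
    ultimately show "y \<in> closed_segment ?v ?v'" unfolding closed_segment_def by blast
  next
    fix y assume "y \<in> closed_segment ?v ?v'"
    then show "y \<in> cell s h x"
      using cell_eq_supports[OF min] supports_closed_segment[OF sv] Rn_closed_segment[OF v(1) v'(1)]
      by blast
  qed
  then have "closed_segment ?v ?v' \<in> bounded_complex s h"
    unfolding bounded_complex_def using x bounded_closed_segment[of ?v ?v'] by (metis (mono_tags, lifting) mem_Collect_eq)
  then show "edge_between (bounded_complex s h) ?v ?v'"
    unfolding edge_between_def using ne v(4) v'(4) by blast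
qed

end

text \<open>By minimality, an end letter different from \<open>a\<close> could be dropped without
  losing a copy of \<open>a\<close>.\<close>

lemma is_block_imp:
  assumes "is_block a (u @ B @ v) B" "0 < count_list (u @ B @ v) a"
  shows "B \<noteq> []" "hd B = a" "last B = a" "a \<notin> set u" "a \<notin> set v"
proof -
  let ?w = "u @ B @ v"
  have cnt: "count_list B a = count_list ?w a"
    and min: "\<And>B'. sublist B' ?w \<Longrightarrow> count_list B' a = count_list ?w a \<Longrightarrow> length B \<le> length B'"
    using assms(1) by (auto simp: is_block_def)
  have "count_list u a = 0" "count_list v a = 0" using cnt by auto
  then show "a \<notin> set u" "a \<notin> set v" by (simp_all add: count_list_0_iff)
  show ne: "B \<noteq> []" using cnt assms(2) by auto
  show "hd B = a"
  proof (rule ccontr)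
    assume "hd B \<noteq> a"
    then have "count_list (tl B) a = count_list ?w a" using ne cnt by (cases B) auto
    moreover have "?w = (u @ [hd B]) @ tl B @ v" using ne by simp
    then have "sublist (tl B) ?w" unfolding sublist_def by blast
    ultimately show False using min[of "tl B"] ne by (cases B) auto
  qed
  show "last B = a"
  proof (rule ccontr)
    assume "last B \<noteq> a"
    then have "count_list (butlast B) a = count_list ?w a"
      using ne cnt by (cases B rule: rev_cases) auto
    moreover have "?w = u @ butlast B @ [last B] @ v" using ne by simp
    then have "sublist (butlast B) ?w" unfolding sublist_def by blast
    ultimately show False using min[of "butlast B"] ne by (cases B rule: rev_cases) auto
  qed
qed

theorem theorem5p13:
  fixes s :: "nat list" and h :: "edge list \<Rightarrow> real"
    and a c :: nat and u1 B u2 w w' :: "nat list"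
  assumes "composition s"
    and "admissible s h"
    and "1 \<le> a" and "a < c" and "c \<le> length s"
    and "w = u1 @ B @ [c] @ u2"
    and "w' = u1 @ [c] @ B @ u2"
    and "stirling_perm s w"
    and "stirling_perm s w'"
    and "is_block a w B"
  shows "edge_between (bounded_complex s h) (vert s h w) (vert s h w') \<and>
    vert s h w' - vert s h w =
      (h (route s (u1 @ [c])) + h (route s (u1 @ B))
         - h (route s u1) - h (route s (u1 @ B @ [c])))
      *\<^sub>R (Poly_Mapping.single a 1 - Poly_Mapping.single c 1)"
proof -
  have w: "w = u1 @ B @ c # u2" and w': "w' = u1 @ c # B @ u2" using assms(6,7) by simp_all
  have "count_list w a = part s a" using assms(3-5,8) by (simp add: stirling_perm_def)
  then have "0 < count_list w a" using assms(3-5) part_pos[OF assms(1), of a] by simp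
  then have "B \<noteq> []" "hd B = a" "last B = a" "a \<notin> set u1" "a \<notin> set (c # u2)"
    using is_block_imp[of a u1 B "c # u2"] assms(10) unfolding w by blast+
  then interpret block_transposition s a c u1 B u2
    using assms(1,4,8,9) unfolding w w' by unfold_locales simp_all
  show ?thesis
    using edge_and_difference[OF assms(2)] unfolding w w' by blast
qed

end
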